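(* Let $n\ge3$ and $m\ge1$ be integers. There is an integer $N$ (depending on $n,m$) such that the following holds for all integers $p_{i,j}\ge N$ ($1\le i\le n-1$, $1\le j\le m$). Let $L$ be the closure of the $n$-braid $$\beta_{n,m}((p_{i,j}))=\prod_{j=1}^m\left(\sigma_1^{p_{1,j}}\sigma_2^{-p_{2,j}}\sigma_3^{p_{3,j}}\cdots\sigma_{n-1}^{(-1)^{n-2}p_{n-1,j}}\right),$$ and, with $s=-t$ and up to multiplication by a unit, write its Alexander polynomial as $\Delta_L(s)=\pm\sum_{i=0}^{d}a_is^i$ with $a_0>0$ and $a_d\ne 0$. Then $$a_0=1,\qquad a_1=(n-2)m+1,\qquad a_2=\frac{(n-2)^2m^2+(3(n-2)+2)m}{2},$$ and $$a_3=\frac{(n-2)^3m^3+6(n-1)(n-2)m^2+(5(n-1)+1)m}{6}\quad\text{if } n>3,$$ $$a_3=\frac{m^3+12m^2+17m-6}{6}\quad\text{if } n=3.$$ Moreover, the sequence $a_0,a_1,a_2,a_3$ is log-concave: $a_1^2\ge |a_0||a_2|$ and $a_2^2\ge|a_1||a_3|$.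
   Context: $\sigma_1,\dots,\sigma_{n-1}$ are the standard generators of the braid group $B_n$; the closure of a braid is oriented with all strands parallel. The Alexander polynomial $\Delta_L(t)\in\mathbb{Z}[t^{\pm1/2}]$ of an oriented link is determined by $\Delta_{\text{unknot}}=1$ and $\Delta_{L_+}(t)-\Delta_{L_-}(t)=(\sqrt t-1/\sqrt t)\,\Delta_{L_0}(t)$. It is normalized by multiplying by a sign and a power of $t^{1/2}$ so that it becomes a polynomial in $t$ with nonzero constant term; it is then rewritten in the variable $s=-t$, so that $\Delta_L(t)=\pm t^{k/2}\sum_{i=0}^{d}a_i(-t)^i$ for some integer $k$. *)

theory Defs
  imports Complex_Main "HOL-Library.Poly_Mapping" "HOL-Computational_Algebra.Polynomial"
begin

section \<open>Oriented link diagrams\<close>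

text \<open>
  A generic planar diagram of an oriented link, read from bottom to top, is a sequence of events
  \<open>(i, e)\<close>: an elementary piece \<open>e\<close> with exactly \<open>i\<close> vertical strands to its left.
  The level between two events is recorded by the list of the orientations of its strands, from
  left to right (\<open>True\<close> is upwards, \<open>False\<close> is downwards).

  \<open>Cup b\<close> is a local minimum whose left leg has orientation \<open>b\<close>; \<open>Cap\<close> is a local maximum.
  \<open>Cross c\<close> is a crossing; the strand from bottom left to top right passes over the
  other one iff \<open>c\<close> holds.
\<close>

datatype piece = Cup bool | Cap | Cross bool

type_synonym event = "nat \<times> piece"
type_synonym diagram = "event list"

fun inputs :: "piece \<Rightarrow> nat" where
  "inputs (Cup b) = 0"
| "inputs Cap = 2"
| "inputs (Cross c) = 2"

fun outputs :: "piece \<Rightarrow> nat" where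
  "outputs (Cup b) = 2"
| "outputs Cap = 0"
| "outputs (Cross c) = 2"

fun step :: "event \<Rightarrow> bool list \<Rightarrow> bool list option" where
  "step (i, Cup b) s =
     (if i \<le> length s then Some (take i s @ [b, \<not> b] @ drop i s) else None)"
| "step (i, Cap) s =
     (if i + 1 < length s \<and> s ! i \<noteq> s ! (i + 1) then Some (take i s @ drop (i + 2) s) else None)"
| "step (i, Cross c) s =
     (if i + 1 < length s then Some (s[i := s ! (i + 1), i + 1 := s ! i]) else None)"

fun run :: "diagram \<Rightarrow> bool list \<Rightarrow> bool list option" where
  "run [] s = Some s"
| "run (e # D) s = (case step e s of None \<Rightarrow> None | Some s' \<Rightarrow> run D s')"

definition link_diagram :: "diagram \<Rightarrow> bool" where
  "link_diagram D \<longleftrightarrow> run D [] = Some []"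

text \<open>
  Turaev's moves, which generate isotopy of links on diagrams of this kind: exchange of heights of
  distant pieces, straightening of a zigzag, passing a strand over or under a local extremum, and
  the three Reidemeister moves. In \<open>reidemeister3\<close>, \<open>a\<close>, \<open>b\<close>, \<open>c\<close> say for strands 1, 2, 3
  (numbered from the left at the bottom) whether 1 is over 2, 1 is over 3, and 2 is over 3,
  respectively; the side condition excludes the two cyclic patterns.
\<close>

inductive local_move :: "diagram \<Rightarrow> diagram \<Rightarrow> bool" where
  exchange:
    "local_move [(i, e), (i + outputs e + k, f)] [(i + inputs e + k, f), (i, e)]"
| zigzag_left: "local_move [(i, Cup b), (i + 1, Cap)] []"
| zigzag_right: "local_move [(i + 1, Cup b), (i, Cap)] []"
| slide_cup: "local_move [(i, Cup b), (i + 1, Cross c)] [(i + 1, Cup b), (i, Cross (\<not> c))]"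
| slide_cap: "local_move [(i + 1, Cross c), (i, Cap)] [(i, Cross (\<not> c)), (i + 1, Cap)]"
| reidemeister1_right: "local_move [(i + 1, Cup b), (i, Cross c), (i + 1, Cap)] []"
| reidemeister1_left: "local_move [(i, Cup b), (i + 1, Cross c), (i, Cap)] []"
| reidemeister2: "local_move [(i, Cross c), (i, Cross (\<not> c))] []"
| reidemeister3:
    "\<not> (a = c \<and> b \<noteq> a) \<Longrightarrow>
     local_move [(i, Cross a), (i + 1, Cross b), (i, Cross c)]
                [(i + 1, Cross c), (i, Cross b), (i + 1, Cross a)]"

definition diagram_move :: "diagram \<Rightarrow> diagram \<Rightarrow> bool" where
  "diagram_move D D' \<longleftrightarrow> link_diagram D \<and> link_diagram D' \<and>
     (\<exists>U V X Y. local_move X Y \<and> D = U @ X @ V \<and> D' = U @ Y @ V)"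

definition isotopic :: "diagram \<Rightarrow> diagram \<Rightarrow> bool" where
  "isotopic = equivclp diagram_move"


section \<open>The Alexander polynomial\<close>

text \<open>
  \<open>\<int>[t\<^sup>\<plusminus>\<^sup>1\<^sup>/\<^sup>2]\<close> is the ring of finitely supported functions on the integers;
  \<open>sqrt_t k\<close> is the \<open>k\<close>-th power of the square root of \<open>t\<close>.
\<close>

type_synonym laurent = "int \<Rightarrow>\<^sub>0 int"

definition sqrt_t :: "int \<Rightarrow> laurent" where
  "sqrt_t k = Poly_Mapping.single k 1"

text \<open>
  At a crossing whose two strands have orientations \<open>s ! i\<close> and \<open>s ! (i + 1)\<close> at the bottom,
  \<open>Cross c\<close> is positive iff \<open>c\<close> agrees with \<open>s ! i = s ! (i + 1)\<close>. The smoothing respecting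
  the orientations is vertical for parallel strands and horizontal for antiparallel ones.
\<close>

definition positive_crossing :: "nat \<Rightarrow> bool list \<Rightarrow> event" where
  "positive_crossing i s = (i, Cross (s ! i = s ! (i + 1)))"

definition negative_crossing :: "nat \<Rightarrow> bool list \<Rightarrow> event" where
  "negative_crossing i s = (i, Cross (s ! i \<noteq> s ! (i + 1)))"

definition smoothing :: "nat \<Rightarrow> bool list \<Rightarrow> diagram" where
  "smoothing i s = (if s ! i = s ! (i + 1) then [] else [(i, Cap), (i, Cup (s ! (i + 1)))])"

definition is_alexander_polynomial :: "(diagram \<Rightarrow> laurent) \<Rightarrow> bool" where
  "is_alexander_polynomial \<Delta> \<longleftrightarrow>
     (\<forall>D D'. link_diagram D \<longrightarrow> link_diagram D' \<longrightarrow> isotopic D D' \<longrightarrow> \<Delta> D = \<Delta> D') \<and>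
     \<Delta> [(0, Cup True), (0, Cap)] = 1 \<and>
     (\<forall>U V i s. run U [] = Some s \<longrightarrow> link_diagram (U @ [positive_crossing i s] @ V) \<longrightarrow>
        \<Delta> (U @ [positive_crossing i s] @ V) - \<Delta> (U @ [negative_crossing i s] @ V) =
        (sqrt_t 1 - sqrt_t (-1)) * \<Delta> (U @ smoothing i s @ V))"

text \<open>
  \<open>P = \<plusminus> t\<^sup>k\<^sup>/\<^sup>2 (a\<^sub>0 + a\<^sub>1 s + \<dots> + a\<^sub>d s\<^sup>d)\<close> with \<open>s = - t\<close> and \<open>a\<^sub>0 > 0\<close>, where the
  \<open>a\<^sub>i\<close> are the coefficients of \<open>A\<close> and \<open>d\<close> is its degree (so \<open>a\<^sub>d \<noteq> 0\<close>, as \<open>A \<noteq> 0\<close>).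
\<close>

definition normalized_in_s :: "laurent \<Rightarrow> int poly \<Rightarrow> bool" where
  "normalized_in_s P A \<longleftrightarrow> coeff A 0 > 0 \<and>
     (\<exists>k. \<exists>\<epsilon>\<in>{1, -1}.
        P = \<epsilon> * sqrt_t k * (\<Sum>i\<le>degree A. of_int (coeff A i) * (- sqrt_t 2) ^ i))"


section \<open>Braids and their closures\<close>

text \<open>
  The letters \<open>(i, True)\<close> and \<open>(i, False)\<close> of a braid word are the generator \<open>\<sigma>\<^sub>i\<close> and its
  inverse (\<open>1 \<le> i < n\<close>). Words are read from bottom to top, and \<open>\<sigma>\<^sub>i\<close> is a positive crossing
  of upward strands.
\<close>

type_synonym braid_word = "(nat \<times> bool) list"

definition sigma_power :: "nat \<Rightarrow> int \<Rightarrow> braid_word" where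
  "sigma_power i k = replicate (nat \<bar>k\<bar>) (i, k > 0)"

text \<open>The \<open>n\<close> closing strands run downwards, nested, to the right of the braid.\<close>

definition braid_closure :: "nat \<Rightarrow> braid_word \<Rightarrow> diagram" where
  "braid_closure n w =
     map (\<lambda>i. (i, Cup True)) [0..<n] @
     map (\<lambda>(i, c). (i - 1, Cross c)) w @
     map (\<lambda>i. (i, Cap)) (rev [0..<n])"

definition beta :: "nat \<Rightarrow> nat \<Rightarrow> (nat \<Rightarrow> nat \<Rightarrow> int) \<Rightarrow> braid_word" where
  "beta n m p =
     concat (map (\<lambda>j. concat (map (\<lambda>i. sigma_power i ((-1) ^ (i - 1) * p i j)) [1..<n])) [1..<m + 1])"

end

theory Submission
  imports Defs
begin

text \<open>
  The skein relation, the Markov moves on the last strand and the vanishing on split closures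
  determine the Alexander polynomial on closed braids, because the Hecke algebra is spanned by
  words in which the last generator occurs at most once. They are also satisfied by the supertrace
  over all strands but the first of the exterior power of the Burau representation, which
  therefore computes it.

  On the eigenspaces of \<open>\<sigma>\<^sub>i\<close>, multiplying by a power of \<open>1 + t\<close> splits each \<open>\<sigma>\<^sub>i\<^sup>p\<close> into a
  part of low and a part of high order in \<open>t\<close>, so for large exponents the lowest coefficients are
  those of the trace of \<open>W\<^sup>m\<close>, where \<open>W = h\<^sub>1 h\<^sub>2 \<dots>\<close> is a product of multiples \<open>h\<^sub>i\<close> of spectral
  projections. By cyclicity \<open>W\<close> may be replaced by a product of the odd \<open>h\<^sub>i\<close> followed by the even
  ones. The odd projections force at least \<open>n div 2\<close> particles and the even ones at most that many,
  and in this degree the odd projector has rank one. Hence the trace of \<open>W\<^sup>m\<close> is a geometric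
  progression in \<open>m\<close> whose ratio, found for \<open>m = 2\<close> from the Markov moves alone, is
  \<open>1 + t + \<dots> + t\<^sup>n\<^sup>-\<^sup>1\<close> up to a unit. So
  \<open>(1 + t)\<^sup>(\<^sup>n\<^sup>-\<^sup>1\<^sup>)\<^sup>m \<Delta> = \<plusminus> t\<^sup>e ((1 + t + \<dots> + t\<^sup>n\<^sup>-\<^sup>1)\<^sup>m\<^sup>-\<^sup>1 + O(t\<^sup>4))\<close>.
\<close>

section \<open>Moves on closed braids\<close>

text \<open>Delta is only characterized, not constructed, so the trace has to be matched with it
  through relations that both satisfy. The first strand is left open because the trace over all
  strands is zero: the supertrace over all exterior powers of M is det(1 - M), and the Burau
  matrices of the generators fix a common vector. With this strand open, cyclicity is available when
  one factor avoids sigma_1, which suffices to gather the odd generators. The squeeze on the number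
  of particles comes from the alternating signs. The eigenvalue of low order is a power of -1/sqrt t
  for sigma_i^p and of 1/sqrt t for sigma_i^(-p), so h_i = sigma_i - sqrt t kills an empty pair of
  sites for odd i, and h_i = sigma_i + 1/sqrt t kills a full pair for even i. The factor 1 + t is,
  up to a unit, the difference of the two eigenvalues of sigma_i, by which a spectral projection
  would have to be divided. The value of a_3 for n = 3 is separate because 1 + t + t^2 has no term
  t^3.\<close>

definition braid_letters :: "nat \<Rightarrow> (nat \<times> 'a) set" where
  "braid_letters n = {1..<n} \<times> UNIV"

definition crossings :: "braid_word \<Rightarrow> diagram" where
  "crossings w = map (\<lambda>(i, c). (i - 1, Cross c)) w"

definition cups :: "nat \<Rightarrow> diagram" where
  "cups n = map (\<lambda>i. (i, Cup True)) [0..<n]"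

definition caps :: "nat \<Rightarrow> diagram" where
  "caps n = map (\<lambda>i. (i, Cap)) (rev [0..<n])"

definition closure_level :: "nat \<Rightarrow> bool list" where
  "closure_level n = replicate n True @ replicate n False"

lemma braid_closure_alt: "braid_closure n w = cups n @ crossings w @ caps n"
  by (simp add: braid_closure_def cups_def crossings_def caps_def)

lemma crossings_append [simp]: "crossings (u @ v) = crossings u @ crossings v"
  by (simp add: crossings_def)

lemma crossings_Nil [simp]: "crossings [] = []"
  by (simp add: crossings_def)

lemma crossings_Cons [simp]: "crossings ((i, c) # w) = (i - 1, Cross c) # crossings w"
  by (simp add: crossings_def)

lemma cups_Suc: "cups (Suc n) = cups n @ [(n, Cup True)]"
  by (simp add: cups_def)

lemma caps_Suc: "caps (Suc n) = (n, Cap) # caps n"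
  by (simp add: caps_def)

lemma run_append: "run (U @ V) s = (case run U s of None \<Rightarrow> None | Some s' \<Rightarrow> run V s')"
  by (induction U arbitrary: s) (auto split: option.splits)

lemma step_cup: "step (n, Cup True) (closure_level n) = Some (closure_level (Suc n))"
  by (simp add: closure_level_def replicate_append_same[symmetric])

lemma step_cap: "step (n, Cap) (closure_level (Suc n)) = Some (closure_level n)"
  by (cases n) (simp_all add: closure_level_def nth_append flip: replicate_append_same)

lemma step_cross:
  assumes "i + 1 < n"
  shows "step (i, Cross c) (closure_level n) = Some (closure_level n)"
proof -
  have "closure_level n ! i" "closure_level n ! (i + 1)"
    using assms by (auto simp: closure_level_def nth_append)
  then show ?thesis
    using assms by (simp add: closure_level_def) (metis (full_types) list_update_id)
qed

lemma run_cups: "run (cups n) [] = Some (closure_level n)"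
proof (induction n)
  case 0
  then show ?case by (simp add: cups_def closure_level_def)
next
  case (Suc n)
  then show ?case by (simp add: cups_Suc run_append step_cup del: step.simps)
qed

lemma run_caps: "run (caps n) (closure_level n) = Some []"
proof (induction n)
  case 0
  then show ?case by (simp add: caps_def closure_level_def)
next
  case (Suc n)
  then show ?case by (simp add: caps_Suc step_cap del: step.simps)
qed

lemma run_crossings:
  "set w \<subseteq> braid_letters n \<Longrightarrow> run (crossings w) (closure_level n) = Some (closure_level n)"
  by (induction w) (auto simp: braid_letters_def step_cross simp del: step.simps)

lemma link_diagram_closure:
  assumes "set w \<subseteq> braid_letters n"
  shows "link_diagram (braid_closure n w)"
  using assms by (simp add: link_diagram_def braid_closure_alt run_append run_cups run_crossings run_caps)

section \<open>Isotopy moves and the skein relation inside a closed braid\<close>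

lemma alexander_local_move:
  assumes "is_alexander_polynomial \<Delta>" "local_move X Y"
    and "link_diagram (U @ X @ V)" "link_diagram (U @ Y @ V)"
  shows "\<Delta> (U @ X @ V) = \<Delta> (U @ Y @ V)"
proof -
  have "diagram_move (U @ X @ V) (U @ Y @ V)"
    using assms unfolding diagram_move_def by blast
  then have "isotopic (U @ X @ V) (U @ Y @ V)"
    unfolding isotopic_def by (rule r_into_equivclp)
  then show ?thesis
    using assms unfolding is_alexander_polynomial_def by blast
qed

lemma closure_local_move:
  assumes "is_alexander_polynomial \<Delta>" "local_move (crossings x) (crossings y)"
    and "set (u @ x @ v) \<subseteq> braid_letters n" "set (u @ y @ v) \<subseteq> braid_letters n"
  shows "\<Delta> (braid_closure n (u @ x @ v)) = \<Delta> (braid_closure n (u @ y @ v))"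
  using alexander_local_move[OF assms(1,2), of "cups n @ crossings u" "crossings v @ caps n"]
    link_diagram_closure[OF assms(3)] link_diagram_closure[OF assms(4)]
  by (simp add: braid_closure_alt)

lemma closure_cancel:
  assumes "is_alexander_polynomial \<Delta>" "set u \<subseteq> braid_letters n" "set v \<subseteq> braid_letters n" "1 \<le> i" "i < n"
  shows "\<Delta> (braid_closure n (u @ [(i, c), (i, \<not> c)] @ v)) = \<Delta> (braid_closure n (u @ v))"
  using closure_local_move[OF assms(1), of "[(i, c), (i, \<not> c)]" "[]" u v n] assms
    reidemeister2[of "i - 1" c]
  by (simp add: braid_letters_def)

lemma closure_braid:
  assumes "is_alexander_polynomial \<Delta>" "set u \<subseteq> braid_letters n" "set v \<subseteq> braid_letters n" "1 \<le> i" "Suc i < n"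
  shows "\<Delta> (braid_closure n (u @ [(i, True), (Suc i, True), (i, True)] @ v)) =
    \<Delta> (braid_closure n (u @ [(Suc i, True), (i, True), (Suc i, True)] @ v))"
  using closure_local_move[OF assms(1), of "[(i, True), (Suc i, True), (i, True)]"
      "[(Suc i, True), (i, True), (Suc i, True)]" u v n] assms
    reidemeister3[of True True True "i - 1"]
  by (simp add: braid_letters_def)

lemma closure_commute:
  assumes "is_alexander_polynomial \<Delta>" "set u \<subseteq> braid_letters n" "set v \<subseteq> braid_letters n"
    and "1 \<le> i" "i + 2 \<le> j" "j < n"
  shows "\<Delta> (braid_closure n (u @ [(i, c), (j, d)] @ v)) = \<Delta> (braid_closure n (u @ [(j, d), (i, c)] @ v))"
proof -
  \<comment> \<open>The generator with index i sits at position i - 1, so j - i - 2 strands separate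
    the two crossings.\<close>
  have "i - 1 + 2 + (j - i - 2) = j - 1"
    using assms by simp
  then have "local_move [(i - 1, Cross c), (j - 1, Cross d)] [(j - 1, Cross d), (i - 1, Cross c)]"
    using exchange[of "i - 1" "Cross c" "j - i - 2" "Cross d"] by (simp only: outputs.simps inputs.simps)
  then show ?thesis
    using closure_local_move[OF assms(1), of "[(i, c), (j, d)]" "[(j, d), (i, c)]" u v n] assms
    by (simp add: braid_letters_def)
qed

lemma closure_skein:
  assumes "is_alexander_polynomial \<Delta>" "set u \<subseteq> braid_letters n" "set v \<subseteq> braid_letters n" "1 \<le> i" "i < n"
  shows "\<Delta> (braid_closure n (u @ (i, True) # v)) - \<Delta> (braid_closure n (u @ (i, False) # v)) =
    (sqrt_t 1 - sqrt_t (-1)) * \<Delta> (braid_closure n (u @ v))"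
proof -
  let ?s = "closure_level n" and ?U = "cups n @ crossings u" and ?V = "crossings v @ caps n"
  \<comment> \<open>Both strands run upwards, so the oriented smoothing is vertical and the smoothed
    diagram is again a closed braid.\<close>
  have eq: "?s ! (i - 1) = ?s ! (i - 1 + 1)"
    using assms(4,5) by (auto simp: closure_level_def nth_append)
  have pos: "positive_crossing (i - 1) ?s = (i - 1, Cross True)"
    and neg: "negative_crossing (i - 1) ?s = (i - 1, Cross False)"
    and smo: "smoothing (i - 1) ?s = []"
    unfolding positive_crossing_def negative_crossing_def smoothing_def using eq by auto
  have "run ?U [] = Some ?s"
    using assms(2) by (simp add: run_append run_cups run_crossings)
  moreover have "link_diagram (?U @ [positive_crossing (i - 1) ?s] @ ?V)"
    unfolding pos using link_diagram_closure[of "u @ (i, True) # v" n] assms(2-5)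
    by (simp add: braid_closure_alt braid_letters_def)
  ultimately have "\<Delta> (?U @ [positive_crossing (i - 1) ?s] @ ?V)
      - \<Delta> (?U @ [negative_crossing (i - 1) ?s] @ ?V) =
    (sqrt_t 1 - sqrt_t (-1)) * \<Delta> (?U @ smoothing (i - 1) ?s @ ?V)"
    using assms(1) unfolding is_alexander_polynomial_def by blast
  then show ?thesis
    unfolding pos neg smo by (simp add: braid_closure_alt)
qed

text \<open>The last cup opens to the right of every strand that \<open>w\<close> crosses, so
  heights are exchanged one crossing at a time. Together with the version for caps this brings both
  ends of the innermost loop next to the letter \<open>n\<close>.\<close>

lemma slide_cup_past_crossings:
  assumes "is_alexander_polynomial \<Delta>" "set w \<subseteq> braid_letters n"
    and "run U [] = Some (closure_level n)" "run V (closure_level (Suc n)) = Some []"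
  shows "\<Delta> (U @ (n, Cup True) # crossings w @ V) = \<Delta> (U @ crossings w @ (n, Cup True) # V)"
  using assms(2,3)
proof (induction w arbitrary: U)
  case (Cons x w)
  obtain i c where x: "x = (i, c)" by (cases x)
  have i: "1 \<le> i" "i < n" and w: "set w \<subseteq> braid_letters n"
    using Cons.prems(1) by (auto simp: x braid_letters_def)
  have w': "set w \<subseteq> braid_letters (Suc n)"
    using w by (auto simp: braid_letters_def)
  have mv: "local_move [(i - 1, Cross c), (n, Cup True)] [(n, Cup True), (i - 1, Cross c)]"
    using exchange[of "i - 1" "Cross c" "n - i - 1" "Cup True"] i by simp
  have *: "step (i - 1, Cross c) (closure_level n) = Some (closure_level n)"
    "step (i - 1, Cross c) (closure_level (Suc n)) = Some (closure_level (Suc n))"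
    using i by (simp_all add: step_cross del: step.simps)
  note * = *[unfolded One_nat_def]
  have "\<Delta> (U @ [(i - 1, Cross c), (n, Cup True)] @ (crossings w @ V)) =
    \<Delta> (U @ [(n, Cup True), (i - 1, Cross c)] @ (crossings w @ V))"
    by (rule alexander_local_move[OF assms(1) mv])
      (simp_all add: link_diagram_def run_append Cons.prems(2) step_cup * run_crossings[OF w']
        assms(4) del: step.simps)
  moreover have "\<Delta> ((U @ [(i - 1, Cross c)]) @ (n, Cup True) # crossings w @ V) =
      \<Delta> ((U @ [(i - 1, Cross c)]) @ crossings w @ (n, Cup True) # V)"
    by (rule Cons.IH[OF w]) (simp add: run_append Cons.prems(2) * del: step.simps)
  ultimately show ?case by (simp add: x)
qed simp

lemma slide_cap_past_crossings:
  assumes "is_alexander_polynomial \<Delta>" "set w \<subseteq> braid_letters n"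
    and "run U [] = Some (closure_level (Suc n))" "run V (closure_level n) = Some []"
  shows "\<Delta> (U @ crossings w @ (n, Cap) # V) = \<Delta> (U @ (n, Cap) # crossings w @ V)"
  using assms(2,3)
proof (induction w arbitrary: U)
  case (Cons x w)
  obtain i c where x: "x = (i, c)" by (cases x)
  have i: "1 \<le> i" "i < n" and w: "set w \<subseteq> braid_letters n"
    using Cons.prems(1) by (auto simp: x braid_letters_def)
  have mv: "local_move [(i - 1, Cross c), (n, Cap)] [(n, Cap), (i - 1, Cross c)]"
    using exchange[of "i - 1" "Cross c" "n - i - 1" "Cap"] i by simp
  have *: "step (i - 1, Cross c) (closure_level n) = Some (closure_level n)"
    "step (i - 1, Cross c) (closure_level (Suc n)) = Some (closure_level (Suc n))"
    using i by (simp_all add: step_cross del: step.simps)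
  note * = *[unfolded One_nat_def]
  have "\<Delta> (U @ [(i - 1, Cross c), (n, Cap)] @ (crossings w @ V)) =
    \<Delta> (U @ [(n, Cap), (i - 1, Cross c)] @ (crossings w @ V))"
    by (rule alexander_local_move[OF assms(1) mv])
      (simp_all add: link_diagram_def run_append Cons.prems(2) step_cap * run_crossings[OF w]
        assms(4) del: step.simps)
  moreover have "\<Delta> ((U @ [(i - 1, Cross c)]) @ crossings w @ (n, Cap) # V) =
      \<Delta> ((U @ [(i - 1, Cross c)]) @ (n, Cap) # crossings w @ V)"
    by (rule Cons.IH[OF w]) (simp add: run_append Cons.prems(2) * del: step.simps)
  ultimately show ?case by (simp add: x)
qed simp

text \<open>Once cup and cap are adjacent to the crossing, the last strand is a kink, which the
  first Reidemeister move removes for either sign \<open>c\<close>.\<close>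

lemma closure_stabilization:
  assumes \<Delta>: "is_alexander_polynomial \<Delta>" and a: "set a \<subseteq> braid_letters n" and b: "set b \<subseteq> braid_letters n"
    and n: "n \<ge> 1"
  shows "\<Delta> (braid_closure (Suc n) (a @ (n, c) # b)) = \<Delta> (braid_closure n (a @ b))"
proof -
  let ?x = "(n - 1, Cross c)"
  have a': "set a \<subseteq> braid_letters (Suc n)" and b': "set b \<subseteq> braid_letters (Suc n)"
    using a b by (auto simp: braid_letters_def)
  have step_x: "step ?x (closure_level (Suc n)) = Some (closure_level (Suc n))"
    using n by (simp add: step_cross del: step.simps)
  note step_x = step_x[unfolded One_nat_def]
  note runs = run_append run_cups run_caps run_crossings[OF a] run_crossings[OF b]
    run_crossings[OF a'] run_crossings[OF b'] step_cup step_cap step_x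
  have "\<Delta> (braid_closure (Suc n) (a @ (n, c) # b)) =
      \<Delta> (cups n @ (n, Cup True) # crossings a @ (?x # crossings b @ (n, Cap) # caps n))"
    by (simp add: braid_closure_alt cups_Suc caps_Suc)
  also have "\<dots> = \<Delta> (cups n @ crossings a @ (n, Cup True) # (?x # crossings b @ (n, Cap) # caps n))"
    by (rule slide_cup_past_crossings[OF \<Delta> a]) (simp_all add: runs del: step.simps)
  also have "\<dots> = \<Delta> ((cups n @ crossings a @ [(n, Cup True), ?x]) @ crossings b @ (n, Cap) # caps n)"
    by simp
  also have "\<dots> = \<Delta> ((cups n @ crossings a @ [(n, Cup True), ?x]) @ (n, Cap) # crossings b @ caps n)"
    by (rule slide_cap_past_crossings[OF \<Delta> b]) (simp_all add: runs del: step.simps)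
  also have "\<dots> = \<Delta> ((cups n @ crossings a) @ [(n, Cup True), ?x, (n, Cap)] @ (crossings b @ caps n))"
    by simp
  also have "\<dots> = \<Delta> ((cups n @ crossings a) @ [] @ (crossings b @ caps n))"
  proof (rule alexander_local_move[OF \<Delta>])
    show "local_move [(n, Cup True), ?x, (n, Cap)] []"
      using reidemeister1_right[of "n - 1" True c] n by simp
  qed (simp_all add: link_diagram_def runs del: step.simps)
  finally show ?thesis by (simp add: braid_closure_alt)
qed

text \<open>Joining the free strand by a positive or by a negative crossing gives the same link
  after stabilization, so the skein relation leaves a nonzero multiple of the value equal to 0, in a
  ring without zero divisors.\<close>

lemma closure_split:
  assumes \<Delta>: "is_alexander_polynomial \<Delta>" and a: "set a \<subseteq> braid_letters n" and n: "n \<ge> 1"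
  shows "\<Delta> (braid_closure (Suc n) a) = 0"
proof -
  have a': "set a \<subseteq> braid_letters (Suc n)"
    using a by (auto simp: braid_letters_def)
  have "(sqrt_t 1 - sqrt_t (-1)) * \<Delta> (braid_closure (Suc n) a) = 0"
    using closure_skein[OF \<Delta>, of "[]" "Suc n" a n] a' n
      closure_stabilization[OF \<Delta>, of "[]" n a True] closure_stabilization[OF \<Delta>, of "[]" n a False] a
    by simp
  moreover have "sqrt_t 1 - sqrt_t (-1) \<noteq> 0"
  proof
    assume "sqrt_t 1 - sqrt_t (-1) = 0"
    then have "Poly_Mapping.lookup (sqrt_t 1) 1 = Poly_Mapping.lookup (sqrt_t (-1)) 1" by simp
    then show False by (simp add: sqrt_t_def lookup_single)
  qed
  ultimately show ?thesis by simp
qed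

lemma closure_unknot:
  assumes "is_alexander_polynomial \<Delta>"
  shows "\<Delta> (braid_closure 1 []) = 1"
  using assms by (simp add: is_alexander_polynomial_def braid_closure_def)

section \<open>Uniqueness of Markov traces\<close>

text \<open>A linear functional on the Hecke algebra with sigma^2 = 1 + z sigma, recorded by its
  values on words so that no quotient algebra has to be built. Words contain positive generators
  only: the skein relation trades every inverse for them.\<close>

definition hecke_functional :: "'a::comm_ring_1 \<Rightarrow> nat \<Rightarrow> (nat list \<Rightarrow> 'a) \<Rightarrow> bool" where
  "hecke_functional z n D \<longleftrightarrow>
    (\<forall>u v i. set u \<subseteq> {1..<n} \<and> set v \<subseteq> {1..<n} \<and> i \<in> {1..<n} \<longrightarrow>
       D (u @ [i, i] @ v) = D (u @ v) + z * D (u @ [i] @ v)) \<and>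
    (\<forall>u v i. set u \<subseteq> {1..<n} \<and> set v \<subseteq> {1..<n} \<and> i \<in> {1..<n} \<and> Suc i \<in> {1..<n} \<longrightarrow>
       D (u @ [i, Suc i, i] @ v) = D (u @ [Suc i, i, Suc i] @ v)) \<and>
    (\<forall>u v i j. set u \<subseteq> {1..<n} \<and> set v \<subseteq> {1..<n} \<and> i \<in> {1..<n} \<and> j \<in> {1..<n} \<and> i + 2 \<le> j \<longrightarrow>
       D (u @ [i, j] @ v) = D (u @ [j, i] @ v))"

lemma
  assumes "hecke_functional z n D" "set u \<subseteq> {1..<n}" "set v \<subseteq> {1..<n}" "i \<in> {1..<n}"
  shows hecke_functional_square: "D (u @ [i, i] @ v) = D (u @ v) + z * D (u @ [i] @ v)"
    and hecke_functional_braid: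
      "Suc i \<in> {1..<n} \<Longrightarrow> D (u @ [i, Suc i, i] @ v) = D (u @ [Suc i, i, Suc i] @ v)"
    and hecke_functional_swap:
      "j \<in> {1..<n} \<Longrightarrow> i + 2 \<le> j \<Longrightarrow> D (u @ [i, j] @ v) = D (u @ [j, i] @ v)"
  using assms unfolding hecke_functional_def by blast+

text \<open>Allows an induction hypothesis about fewer generators to be applied to a factor in the
  middle of a word.\<close>

lemma hecke_functional_context:
  assumes "hecke_functional z n D" "set x \<subseteq> {1..<n}" "set y \<subseteq> {1..<n}"
  shows "hecke_functional z n (\<lambda>v. D (x @ v @ y))"
  unfolding hecke_functional_def
proof (intro conjI allI impI; elim conjE)
  fix u v i assume "set u \<subseteq> {1..<n}" "set v \<subseteq> {1..<n}" "i \<in> {1..<n}"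
  then show "D (x @ (u @ [i, i] @ v) @ y) = D (x @ (u @ v) @ y) + z * D (x @ (u @ [i] @ v) @ y)"
    using hecke_functional_square[OF assms(1), of "x @ u" "v @ y" i] assms(2,3) by simp
next
  fix u v i assume "set u \<subseteq> {1..<n}" "set v \<subseteq> {1..<n}" "i \<in> {1..<n}" "Suc i \<in> {1..<n}"
  then show "D (x @ (u @ [i, Suc i, i] @ v) @ y) = D (x @ (u @ [Suc i, i, Suc i] @ v) @ y)"
    using hecke_functional_braid[OF assms(1), of "x @ u" "v @ y" i] assms(2,3) by simp
next
  fix u v i j assume "set u \<subseteq> {1..<n}" "set v \<subseteq> {1..<n}" "i \<in> {1..<n}" "j \<in> {1..<n}" "i + 2 \<le> j"
  then show "D (x @ (u @ [i, j] @ v) @ y) = D (x @ (u @ [j, i] @ v) @ y)"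
    using hecke_functional_swap[OF assms(1), of "x @ u" "v @ y" i j] assms(2,3) by simp
qed

lemma hecke_functional_diff:
  assumes "hecke_functional z n D" "hecke_functional z n E"
  shows "hecke_functional z n (\<lambda>w. D w - E w)"
  unfolding hecke_functional_def
proof (intro conjI allI impI; elim conjE)
  fix u v i assume "set u \<subseteq> {1..<n}" "set v \<subseteq> {1..<n}" "i \<in> {1..<n}"
  from hecke_functional_square[OF assms(1) this] hecke_functional_square[OF assms(2) this]
  show "D (u @ [i, i] @ v) - E (u @ [i, i] @ v) =
      D (u @ v) - E (u @ v) + z * (D (u @ [i] @ v) - E (u @ [i] @ v))"
    by (simp only: algebra_simps)
next
  fix u v i assume "set u \<subseteq> {1..<n}" "set v \<subseteq> {1..<n}" "i \<in> {1..<n}" "Suc i \<in> {1..<n}"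
  from hecke_functional_braid[OF assms(1) this] hecke_functional_braid[OF assms(2) this]
  show "D (u @ [i, Suc i, i] @ v) - E (u @ [i, Suc i, i] @ v) =
      D (u @ [Suc i, i, Suc i] @ v) - E (u @ [Suc i, i, Suc i] @ v)"
    by (simp only:)
next
  fix u v i j assume "set u \<subseteq> {1..<n}" "set v \<subseteq> {1..<n}" "i \<in> {1..<n}" "j \<in> {1..<n}" "i + 2 \<le> j"
  from hecke_functional_swap[OF assms(1) this] hecke_functional_swap[OF assms(2) this]
  show "D (u @ [i, j] @ v) - E (u @ [i, j] @ v) = D (u @ [j, i] @ v) - E (u @ [j, i] @ v)"
    by (simp only:)
qed

lemma hecke_functional_commute:
  assumes "hecke_functional z n D" "set u \<subseteq> {1..<n}" "set v \<subseteq> {1..<n}" "j \<in> {1..<n}"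
    and "set w \<subseteq> {1..<n}" "\<And>i. i \<in> set w \<Longrightarrow> i + 2 \<le> j"
  shows "D (u @ [j] @ w @ v) = D (u @ w @ [j] @ v)"
  using assms(2,5,6)
proof (induction w arbitrary: u)
  case (Cons i w)
  have "D (u @ [i, j] @ (w @ v)) = D (u @ [j, i] @ (w @ v))"
    using assms(3,4) Cons.prems by (intro hecke_functional_swap[OF assms(1)]) auto
  moreover have "D ((u @ [i]) @ [j] @ w @ v) = D ((u @ [i]) @ w @ [j] @ v)"
    by (rule Cons.IH) (use Cons.prems in auto)
  ultimately show ?case by simp
qed simp

text \<open>A word with two letters \<open>l\<close> is reduced by making \<open>l - 1\<close> occur at most once between them: then
  they meet in \<open>l l\<close> or in \<open>l (l - 1) l\<close>, and the square or the braid relation removes one.\<close>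

lemma hecke_functional_eq_0:
  fixes D :: "nat list \<Rightarrow> 'a::comm_ring_1"
  assumes "hecke_functional z n D" "l < n"
    and "\<And>x. set x \<subseteq> {1..l} \<Longrightarrow> count_list x l \<le> 1 \<Longrightarrow> D x = 0"
    and "set x \<subseteq> {1..l}"
  shows "D x = 0"
  using assms
proof (induction l arbitrary: D x)
  case 0
  then have "x = []" by simp
  then show ?case using "0.prems"(3)[of "[]"] by simp
next
  case (Suc l)
  have below: "set w \<subseteq> {1..<k}" if "set w \<subseteq> {1..k}" "k \<notin> set w" for w and k :: nat
  proof
    fix i assume "i \<in> set w"
    then have "i \<in> {1..k}" "i \<noteq> k"
      using that by blast+
    then show "i \<in> {1..<k}" by simp
  qed
  note D = Suc.prems(1)
  \<comment> \<open>Inside the induction on the largest generator runs one on the number of its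
    occurrences; the outer hypothesis serves for the factor between two of them.\<close>
  from Suc.prems(4) show ?case
  proof (induction "count_list x (Suc l)" arbitrary: x rule: less_induct)
    case less
    show ?case
    proof (cases "count_list x (Suc l) \<le> 1")
      case True
      then show ?thesis using Suc.prems(3) less.prems by blast
    next
      case False
      then have "Suc l \<in> set x"
        by (auto simp: count_list_0_iff intro: ccontr)
      from split_list_first[OF this]
      obtain u x' where x1: "x = u @ Suc l # x'" "Suc l \<notin> set u"
        by blast
      have "count_list u (Suc l) = 0"
        using x1(2) by simp
      then have "count_list x' (Suc l) \<noteq> 0"
        using False x1 by simp
      then have "Suc l \<in> set x'"
        by (simp add: count_list_0_iff)
      from split_list_first[OF this]
      obtain v y where x2: "x' = v @ Suc l # y" "Suc l \<notin> set v"
        by blast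
      have x: "x = u @ [Suc l] @ v @ [Suc l] @ y"
        using x1 x2 by simp
      have uy: "set u \<subseteq> {1..Suc l}" "set y \<subseteq> {1..Suc l}"
        using less.prems unfolding x by auto
      have "set v \<subseteq> {1..Suc l}"
        using less.prems unfolding x by auto
      with x2(2) have v: "set v \<subseteq> {1..l}"
        using below[of v "Suc l"] by (simp add: atLeastLessThanSuc_atLeastAtMost)
      have small: "set w \<subseteq> {1..<n}" if "set w \<subseteq> {1..Suc l}" for w
        using that Suc.prems(2) by auto
      have mid: "D ((u @ [Suc l]) @ v' @ ([Suc l] @ y)) = 0"
        if v': "set v' \<subseteq> {1..l}" "count_list v' l \<le> 1" for v'
      proof (cases "l \<in> set v'")
        case False
        then have "set v' \<subseteq> {1..<l}"
          using v' below by simp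
        then have w: "set v' \<subseteq> {1..<n}" "\<And>i. i \<in> set v' \<Longrightarrow> i + 2 \<le> Suc l"
          using Suc.prems(2) by auto
        have "D (u @ [Suc l] @ v' @ ([Suc l] @ y)) = D (u @ v' @ [Suc l] @ ([Suc l] @ y))"
          using w small uy Suc.prems(2) by (intro hecke_functional_commute[OF D]) auto
        also have "\<dots> = D ((u @ v') @ [Suc l, Suc l] @ y)"
          by simp
        also have "\<dots> = D ((u @ v') @ y) + z * D ((u @ v') @ [Suc l] @ y)"
        proof -
          have "set (u @ v') \<subseteq> {1..<n}" "set y \<subseteq> {1..<n}" "Suc l \<in> {1..<n}"
            using small w uy Suc.prems(2) by auto
          then show ?thesis by (rule hecke_functional_square[OF D])
        qed
        also have "D ((u @ v') @ y) = 0"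
        proof (rule less.hyps)
          show "set ((u @ v') @ y) \<subseteq> {1..Suc l}" using uy v' by auto
          have "count_list v' (Suc l) = 0" using v'(1) by (auto simp: count_list_0_iff)
          then show "count_list ((u @ v') @ y) (Suc l) < count_list x (Suc l)" by (simp add: x)
        qed
        also have "D ((u @ v') @ [Suc l] @ y) = 0"
        proof (rule less.hyps)
          show "set ((u @ v') @ [Suc l] @ y) \<subseteq> {1..Suc l}" using uy v' by auto
          have "count_list v' (Suc l) = 0" using v'(1) by (auto simp: count_list_0_iff)
          then show "count_list ((u @ v') @ [Suc l] @ y) (Suc l) < count_list x (Suc l)" by (simp add: x)
        qed
        finally show ?thesis by simp
      next
        case True
        from split_list_first[OF this]
        obtain a b where ab: "v' = a @ l # b" "l \<notin> set a"
          by blast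
        then have "l \<notin> set b"
          using v'(2) by (simp add: count_list_0_iff)
        with ab v' have ab': "set a \<subseteq> {1..<l}" "set b \<subseteq> {1..<l}" and l: "1 \<le> l"
          using below[of a l] below[of b l] by simp_all
        have sm: "set a \<subseteq> {1..<n}" "set b \<subseteq> {1..<n}" "set u \<subseteq> {1..<n}" "set y \<subseteq> {1..<n}"
          "Suc l \<in> {1..<n}" "l \<in> {1..<n}"
          using ab' small uy Suc.prems(2) l by auto
        have "D (u @ [Suc l] @ a @ ([l] @ b @ [Suc l] @ y)) = D (u @ a @ [Suc l] @ ([l] @ b @ [Suc l] @ y))"
          using sm ab' by (intro hecke_functional_commute[OF D]) auto
        also have "\<dots> = D ((u @ a @ [Suc l, l]) @ b @ [Suc l] @ y)"
          by simp
        also have "\<dots> = D ((u @ a @ [Suc l, l]) @ [Suc l] @ b @ y)"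
          using sm ab' by (intro hecke_functional_commute[OF D, symmetric]) auto
        also have "\<dots> = D ((u @ a) @ [Suc l, l, Suc l] @ (b @ y))"
          by simp
        also have "\<dots> = D ((u @ a) @ [l, Suc l, l] @ (b @ y))"
          using sm by (intro hecke_functional_braid[OF D, symmetric]) auto
        also have "\<dots> = 0"
        proof (rule less.hyps)
          show "set ((u @ a) @ [l, Suc l, l] @ (b @ y)) \<subseteq> {1..Suc l}"
            using uy ab' l by auto
          have "count_list a (Suc l) = 0" "count_list b (Suc l) = 0"
            using ab' by (auto simp: count_list_0_iff)
          then show "count_list ((u @ a) @ [l, Suc l, l] @ (b @ y)) (Suc l) < count_list x (Suc l)"
            by (simp add: x)
        qed
        finally show ?thesis by (simp add: ab)
      qed
      \<comment> \<open>As a functional of the middle factor alone, this falls under the outer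
        hypothesis, whose assumption on words with at most one letter \<open>l\<close> is
        \<open>mid\<close>.\<close>
      have "hecke_functional z n (\<lambda>v. D ((u @ [Suc l]) @ v @ ([Suc l] @ y)))"
        using D uy small Suc.prems(2) by (intro hecke_functional_context) auto
      then have "(\<lambda>v. D ((u @ [Suc l]) @ v @ ([Suc l] @ y))) v = 0"
        by (rule Suc.IH[OF _ Suc_lessD[OF Suc.prems(2)] _ v]) (rule mid)
      then show ?thesis
        by (simp add: x)
    qed
  qed
qed

text \<open>A Markov trace in the normalization of the Alexander polynomial. Since a free strand
  gives 0, the relation sigma^(-1) = sigma - z makes negative stabilization agree with the positive
  one required here.\<close>

definition markov_family :: "'a::comm_ring_1 \<Rightarrow> (nat \<Rightarrow> nat list \<Rightarrow> 'a) \<Rightarrow> bool" where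
  "markov_family z F \<longleftrightarrow>
    (\<forall>n. hecke_functional z n (F n)) \<and>
    (\<forall>n a b. 1 \<le> n \<and> set a \<subseteq> {1..<n} \<and> set b \<subseteq> {1..<n} \<longrightarrow> F (Suc n) (a @ [n] @ b) = F n (a @ b)) \<and>
    (\<forall>n a. 1 \<le> n \<and> set a \<subseteq> {1..<n} \<longrightarrow> F (Suc n) a = 0) \<and>
    F 1 [] = 1"

theorem markov_family_unique:
  assumes F: "markov_family z F" and G: "markov_family z G"
    and "1 \<le> n" "set x \<subseteq> {1..<n}"
  shows "F n x = G n x"
  using assms(3,4)
proof (induction n arbitrary: x rule: nat_induct_at_least)
  case base
  then show ?case using F G by (simp add: markov_family_def)
next
  case (Suc n)
  have below: "set w \<subseteq> {1..<k}" if "set w \<subseteq> {1..k}" "k \<notin> set w" for w and k :: nat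
  proof
    fix i assume "i \<in> set w"
    then have "i \<in> {1..k}" "i \<noteq> k"
      using that by blast+
    then show "i \<in> {1..<k}" by simp
  qed
  have "F (Suc n) x - G (Suc n) x = 0"
  proof (rule hecke_functional_eq_0[of z "Suc n" "\<lambda>x. F (Suc n) x - G (Suc n) x" n])
    show "hecke_functional z (Suc n) (\<lambda>x. F (Suc n) x - G (Suc n) x)"
      using F G by (intro hecke_functional_diff) (auto simp: markov_family_def)
    show "set x \<subseteq> {1..n}" using Suc.prems by auto
  next
    fix y assume y: "set y \<subseteq> {1..n}" "count_list y n \<le> 1"
    show "F (Suc n) y - G (Suc n) y = 0"
    proof (cases "n \<in> set y")
      case False
      then have "set y \<subseteq> {1..<n}"
        using y below by simp
      then show ?thesis using F G Suc.hyps by (simp add: markov_family_def)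
    next
      case True
      from split_list_first[OF this]
      obtain a b where ab: "y = a @ n # b" "n \<notin> set a"
        by blast
      then have "n \<notin> set b"
        using y(2) by (simp add: count_list_0_iff)
      with ab y have ab': "set a \<subseteq> {1..<n}" "set b \<subseteq> {1..<n}"
        using below[of a n] below[of b n] by simp_all
      then have "F (Suc n) (a @ [n] @ b) = F n (a @ b)" "G (Suc n) (a @ [n] @ b) = G n (a @ b)"
        using F G Suc.hyps unfolding markov_family_def by blast+
      moreover have "F n (a @ b) = G n (a @ b)"
        using ab' by (intro Suc.IH) auto
      ultimately show ?thesis by (simp add: ab)
    qed
  qed simp
  then show ?case by simp
qed

lemma alexander_markov_family:
  assumes "is_alexander_polynomial \<Delta>"
  shows "markov_family (sqrt_t 1 - sqrt_t (-1)) (\<lambda>n x. \<Delta> (braid_closure n (map (\<lambda>i. (i, True)) x)))"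
    (is "markov_family ?z ?F")
proof -
  have lett: "set (map (\<lambda>i. (i, True)) u) \<subseteq> braid_letters n" if "set u \<subseteq> {1..<n}" for u n
    using that by (auto simp: braid_letters_def)
  have square: "?F n (u @ [i, i] @ v) = ?F n (u @ v) + ?z * ?F n (u @ [i] @ v)"
    if "set u \<subseteq> {1..<n}" "set v \<subseteq> {1..<n}" "i \<in> {1..<n}" for n u v i
  proof -
    \<comment> \<open>The skein relation is used at the second of the two equal letters; changing
      its sign makes the pair cancel.\<close>
    have "set (map (\<lambda>i. (i, True)) u @ [(i, True)]) \<subseteq> braid_letters n"
      using that by (auto simp: braid_letters_def)
    from closure_skein[OF assms this lett[OF that(2)], of i]
      closure_cancel[OF assms lett[OF that(1)] lett[OF that(2)], of i True] that(3)
    show ?thesis by (simp add: algebra_simps)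
  qed
  have "hecke_functional ?z n (?F n)" for n
    unfolding hecke_functional_def
  proof (intro conjI allI impI; elim conjE)
    fix u v i assume "set u \<subseteq> {1..<n}" "set v \<subseteq> {1..<n}" "i \<in> {1..<n}"
    then show "?F n (u @ [i, i] @ v) = ?F n (u @ v) + ?z * ?F n (u @ [i] @ v)"
      by (rule square)
  next
    fix u v i assume "set u \<subseteq> {1..<n}" "set v \<subseteq> {1..<n}" "i \<in> {1..<n}" "Suc i \<in> {1..<n}"
    then show "?F n (u @ [i, Suc i, i] @ v) = ?F n (u @ [Suc i, i, Suc i] @ v)"
      using closure_braid[OF assms lett[of u n] lett[of v n], of i] by simp
  next
    fix u v i j assume "set u \<subseteq> {1..<n}" "set v \<subseteq> {1..<n}" "i \<in> {1..<n}" "j \<in> {1..<n}" "i + 2 \<le> j"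
    then show "?F n (u @ [i, j] @ v) = ?F n (u @ [j, i] @ v)"
      using closure_commute[OF assms lett[of u n] lett[of v n], of i j True True] by simp
  qed
  moreover have "?F (Suc n) (a @ [n] @ b) = ?F n (a @ b)"
    if "1 \<le> n" "set a \<subseteq> {1..<n}" "set b \<subseteq> {1..<n}" for n a b
    using closure_stabilization[OF assms lett[OF that(2)] lett[OF that(3)] that(1)] by simp
  moreover have "?F (Suc n) a = 0" if "1 \<le> n" "set a \<subseteq> {1..<n}" for n a
    using closure_split[OF assms lett[OF that(2)] that(1)] .
  moreover have "?F 1 [] = 1"
    using closure_unknot[OF assms] by simp
  ultimately show ?thesis
    unfolding markov_family_def by blast
qed

section \<open>The trace on the exterior algebra\<close>

abbreviation rt :: laurent where "rt \<equiv> sqrt_t 1"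
abbreviation irt :: laurent where "irt \<equiv> sqrt_t (-1)"

lemma sqrt_t_mult: "sqrt_t a * sqrt_t b = sqrt_t (a + b)"
  by (simp add: sqrt_t_def mult_single)

lemma sqrt_t_0 [simp]: "sqrt_t 0 = 1"
  by (simp add: sqrt_t_def)

lemma rt_irt [simp]: "rt * irt = 1" "irt * rt = 1" "rt * (irt * x) = x" "irt * (rt * x) = x"
  by (simp_all add: sqrt_t_mult flip: mult.assoc)

lemma sqrt_t_power: "sqrt_t a ^ k = sqrt_t (a * int k)"
  by (induction k) (simp_all add: sqrt_t_mult algebra_simps)

definition swap_site :: "nat \<Rightarrow> nat set \<Rightarrow> nat set" where
  "swap_site i s = {x. (if x = i then Suc i else if x = Suc i then i else x) \<in> s}"

lemma swap_site_twice [simp]: "swap_site i (swap_site i s) = s"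
  by (auto simp: swap_site_def)

lemma card_swap_site [simp]: "card (swap_site i s) = card s"
proof -
  let ?f = "\<lambda>x. if x = i then Suc i else if x = Suc i then i else x"
  have "inj ?f" by (auto simp: inj_def)
  moreover have "s \<subseteq> range ?f"
  proof
    fix x assume "x \<in> s"
    have "x = ?f (?f x)" by auto
    then show "x \<in> range ?f" by blast
  qed
  moreover have "swap_site i s = ?f -` s" by (auto simp: swap_site_def)
  ultimately show ?thesis using card_vimage_inj[of ?f s] by metis
qed

lemma swap_site_subset: "1 \<le> i \<Longrightarrow> i < n \<Longrightarrow> s \<subseteq> {1..n} \<Longrightarrow> swap_site i s \<subseteq> {1..n}"
  by (force simp: swap_site_def split: if_splits)

lemma finite_swap_site: "finite s \<Longrightarrow> finite (swap_site i s)"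
  by (rule finite_subset[of _ "insert i (insert (Suc i) s)"]) (auto simp: swap_site_def)

text \<open>A function on finite sets of sites is a vector of the exterior algebra; \<open>fock_op i c\<close> is
  \<open>\<sigma>\<^sub>i + c\<close> acting on it, where \<open>\<sigma>\<^sub>i\<close> is \<open>\<surd>t\<close> times the exterior power of the Burau matrix.\<close>

definition fock_op :: "nat \<Rightarrow> laurent \<Rightarrow> (nat set \<Rightarrow> laurent) \<Rightarrow> nat set \<Rightarrow> laurent" where
  "fock_op i c \<phi> s =
    (if i \<in> s \<longleftrightarrow> Suc i \<in> s then (if i \<in> s then - irt else rt) * \<phi> s
     else \<phi> (swap_site i s) + (if i \<in> s then rt - irt else 0) * \<phi> s) + c * \<phi> s"

fun fock :: "(nat \<times> laurent) list \<Rightarrow> (nat set \<Rightarrow> laurent) \<Rightarrow> nat set \<Rightarrow> laurent" where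
  "fock [] \<phi> = \<phi>"
| "fock ((i, c) # w) \<phi> = fock_op i c (fock w \<phi>)"

lemma fock_append: "fock (u @ v) \<phi> = fock u (fock v \<phi>)"
  by (induction u) auto

lemma fock_op_const: "fock_op i c \<phi> s = fock_op i 0 \<phi> s + c * \<phi> s"
  by (simp add: fock_op_def)

lemma fock_op_linear:
  "fock_op i c (\<lambda>s. a * \<phi> s + b * \<psi> s) s = a * fock_op i c \<phi> s + b * fock_op i c \<psi> s"
  by (simp add: fock_op_def algebra_simps)

lemma fock_linear:
  "fock w (\<lambda>s. a * \<phi> s + b * \<psi> s) s = a * fock w \<phi> s + b * fock w \<psi> s"
proof (induction w arbitrary: s)
  case (Cons x w)
  obtain i c where x: "x = (i, c)" by (cases x)
  have "fock w (\<lambda>s. a * \<phi> s + b * \<psi> s) = (\<lambda>s. a * fock w \<phi> s + b * fock w \<psi> s)"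
    using Cons.IH by auto
  then show ?case by (simp add: x fock_op_linear)
qed simp

lemma fock_scale: "fock w (\<lambda>s. a * \<phi> s) s = a * fock w \<phi> s"
  using fock_linear[of w a \<phi> 0 "\<lambda>_. 0"] by simp

lemma fock_zero: "fock w (\<lambda>s. 0) s = 0"
  using fock_scale[of w 0 "\<lambda>_. 0"] by simp

text \<open>The eigenvalues of sigma_i are \<open>rt\<close> and \<open>- irt\<close>: their sum is
  the skein coefficient and their product is -1.\<close>

lemma fock_op_square:
  "fock_op i 0 (fock_op i 0 \<phi>) s = \<phi> s + (rt - irt) * fock_op i 0 \<phi> s"
proof -
  have m: "i \<in> swap_site i s \<longleftrightarrow> Suc i \<in> s" "Suc i \<in> swap_site i s \<longleftrightarrow> i \<in> s"
    by (simp_all add: swap_site_def)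
  show ?thesis
    by (cases "i \<in> s"; cases "Suc i \<in> s") (simp_all add: fock_op_def m algebra_simps)
qed

lemma fock_op_commute:
  assumes "i + 2 \<le> j"
  shows "fock_op i c (fock_op j d \<phi>) s = fock_op j d (fock_op i c \<phi>) s"
proof -
  have m: "i \<in> swap_site j s \<longleftrightarrow> i \<in> s" "Suc i \<in> swap_site j s \<longleftrightarrow> Suc i \<in> s"
    "j \<in> swap_site i s \<longleftrightarrow> j \<in> s" "Suc j \<in> swap_site i s \<longleftrightarrow> Suc j \<in> s"
    "swap_site j (swap_site i s) = swap_site i (swap_site j s)"
    using assms by (auto simp: swap_site_def)
  show ?thesis
    by (simp add: fock_op_def m algebra_simps)
qed

lemma fock_op_braid:
  "fock_op i 0 (fock_op (Suc i) 0 (fock_op i 0 \<phi>)) s =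
    fock_op (Suc i) 0 (fock_op i 0 (fock_op (Suc i) 0 \<phi>)) s"
proof -
  have m: "i \<in> swap_site i s \<longleftrightarrow> Suc i \<in> s" "Suc i \<in> swap_site i s \<longleftrightarrow> i \<in> s"
    "Suc (Suc i) \<in> swap_site i s \<longleftrightarrow> Suc (Suc i) \<in> s"
    "i \<in> swap_site (Suc i) s \<longleftrightarrow> i \<in> s" "Suc i \<in> swap_site (Suc i) s \<longleftrightarrow> Suc (Suc i) \<in> s"
    "Suc (Suc i) \<in> swap_site (Suc i) s \<longleftrightarrow> Suc i \<in> s" for s
    by (simp_all add: swap_site_def)
  show ?thesis
    by (cases "i \<in> s"; cases "Suc i \<in> s"; cases "Suc (Suc i) \<in> s")
      (simp_all add: fock_op_def m algebra_simps)
qed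

definition indicator_vec :: "nat set \<Rightarrow> nat set \<Rightarrow> laurent" where
  "indicator_vec s x = (if x = s then 1 else 0)"

text \<open>The supertrace over the strands \<open>2, \<dots>, n\<close>, with the first strand left open and empty.\<close>

definition open_trace :: "nat \<Rightarrow> (nat \<times> laurent) list \<Rightarrow> laurent" where
  "open_trace n w = (\<Sum>s\<in>Pow {2..n}. (-1) ^ card s * fock w (indicator_vec s) s)"

lemma open_trace_linear:
  assumes "\<And>\<phi> s. fock x \<phi> s = a * fock y \<phi> s + b * fock y' \<phi> s"
  shows "open_trace n (u @ x @ v) = a * open_trace n (u @ y @ v) + b * open_trace n (u @ y' @ v)"
proof -
  have "fock x \<phi> = (\<lambda>s. a * fock y \<phi> s + b * fock y' \<phi> s)" for \<phi>
    using assms by auto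
  then show ?thesis
    by (simp add: open_trace_def fock_append fock_linear sum_distrib_left sum.distrib algebra_simps)
qed

section \<open>Markov properties of the open trace\<close>

lemma fock_invariant_factor:
  assumes "\<And>i c s. (i, c) \<in> set w \<Longrightarrow> g (swap_site i s) = g s"
  shows "fock w (\<lambda>s. g s * \<phi> s) s = g s * fock w \<phi> s"
  using assms
proof (induction w arbitrary: s)
  case (Cons x w)
  obtain i c where x: "x = (i, c)" by (cases x)
  have "fock w (\<lambda>s. g s * \<phi> s) = (\<lambda>s. g s * fock w \<phi> s)"
    by (rule ext, rule Cons.IH, rule Cons.prems) auto
  moreover have "g (swap_site i s) = g s"
    using Cons.prems[of i c s] x by simp
  ultimately show ?case by (simp add: x fock_op_def algebra_simps)
qed simp

text \<open>Applied to maps that add or remove a particle at a site which the word does not touch.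
  In the same way, \<open>fock_invariant_factor\<close> treats the occupation of such a site as a
  conserved quantity.\<close>

lemma fock_pullback:
  assumes "\<And>i c s. (i, c) \<in> set w \<Longrightarrow>
    g (swap_site i s) = swap_site i (g s) \<and> (i \<in> g s \<longleftrightarrow> i \<in> s) \<and> (Suc i \<in> g s \<longleftrightarrow> Suc i \<in> s)"
  shows "fock w (\<lambda>s. \<phi> (g s)) s = fock w \<phi> (g s)"
  using assms
proof (induction w arbitrary: s)
  case (Cons x w)
  obtain i c where x: "x = (i, c)" by (cases x)
  have "fock w (\<lambda>s. \<phi> (g s)) = (\<lambda>s. fock w \<phi> (g s))"
    by (rule ext, rule Cons.IH, rule Cons.prems) auto
  then show ?case using Cons.prems[of i c s] x by (simp add: fock_op_def)
qed simp

lemma fock_insert: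
  assumes "set w \<subseteq> braid_letters n"
  shows "fock w \<phi> (insert (Suc n) s) = fock w (\<lambda>s. \<phi> (insert (Suc n) s)) s"
  using assms by (intro fock_pullback[symmetric]) (auto simp: braid_letters_def swap_site_def)

lemma fock_remove:
  assumes "set w \<subseteq> braid_letters n"
  shows "fock w \<phi> (s - {Suc n}) = fock w (\<lambda>s. \<phi> (s - {Suc n})) s"
  using assms by (intro fock_pullback[symmetric]) (force simp: braid_letters_def swap_site_def split: if_splits)

text \<open>Takes the supertrace over the last strand first: its occupied and its empty state
  contribute with opposite signs.\<close>

lemma sum_Pow_Suc:
  assumes "1 \<le> n"
  shows "(\<Sum>s\<in>Pow {2..Suc n}. (-1) ^ card s * f s) =
    (\<Sum>s\<in>Pow {2..n}. (-1) ^ card s * (f s - f (insert (Suc n) s)) :: laurent)"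
proof -
  have P: "Pow {2..Suc n} = Pow {2..n} \<union> insert (Suc n) ` Pow {2..n}"
    using assms by (simp add: atLeastAtMostSuc_conv Pow_insert)
  have inj: "inj_on (insert (Suc n)) (Pow {2..n})"
    by (rule inj_onI) (metis Diff_insert_absorb Pow_iff atLeastAtMost_iff not_less_eq_eq order_refl subsetD)
  have c: "card (insert (Suc n) s) = Suc (card s)" if "s \<in> Pow {2..n}" for s
  proof -
    have "finite s" "Suc n \<notin> s" using that finite_subset[of s "{2..n}"] by auto
    then show ?thesis by simp
  qed
  have "(\<Sum>s\<in>Pow {2..Suc n}. (-1) ^ card s * f s) =
    (\<Sum>s\<in>Pow {2..n}. (-1) ^ card s * f s) + (\<Sum>s\<in>insert (Suc n) ` Pow {2..n}. (-1) ^ card s * f s)"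
    unfolding P by (rule sum.union_disjoint) auto
  also have "(\<Sum>s\<in>insert (Suc n) ` Pow {2..n}. (-1) ^ card s * f s) =
      (\<Sum>s\<in>Pow {2..n}. - ((-1) ^ card s * f (insert (Suc n) s)))"
    by (subst sum.reindex[OF inj]) (auto intro!: sum.cong simp: c)
  finally show ?thesis
    by (simp add: sum_subtractf algebra_simps sum_negf)
qed

text \<open>The supertrace of sigma_n + c over its last strand is the scalar \<open>rt\<close>. The
  constant c cancels between the empty and the occupied state; what remains is rt - 0 if site n is
  empty and (rt - irt) - (- irt) if it is occupied.\<close>

lemma open_trace_stabilization:
  assumes "1 \<le> n" and a: "set a \<subseteq> braid_letters n" and b: "set b \<subseteq> braid_letters n"
  shows "open_trace (Suc n) (a @ [(n, c)] @ b) = rt * open_trace n (a @ b)"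
proof -
  have key: "fock (a @ [(n, c)] @ b) (indicator_vec s) s
      - fock (a @ [(n, c)] @ b) (indicator_vec (insert (Suc n) s)) (insert (Suc n) s) =
    rt * fock (a @ b) (indicator_vec s) s" if s: "s \<in> Pow {2..n}" for s
  proof -
    define \<Phi> where "\<Phi> = fock b (indicator_vec s)"
    \<comment> \<open>Since \<open>b\<close> does not touch the last site, its results factor into
      the occupation of that site and the common vector \<Phi> on the other sites.\<close>
    define A0 where "A0 x = (if Suc n \<in> x then 0 else 1) * \<Phi> (x - {Suc n})" for x
    define A1 where "A1 x = (if Suc n \<in> x then 1 else 0) * \<Phi> (x - {Suc n})" for x
    have ns: "Suc n \<notin> s" using s by auto
    have inv: "Suc n \<in> swap_site i x \<longleftrightarrow> Suc n \<in> x" if "(i, c) \<in> set b" for i c x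
      using that b by (auto simp: braid_letters_def swap_site_def)
    have d0: "indicator_vec s =
        (\<lambda>x. (if Suc n \<in> x then 0 else 1) * (\<lambda>x. indicator_vec s (x - {Suc n})) x)"
      using ns by (auto simp: indicator_vec_def fun_eq_iff)
    have d1: "indicator_vec (insert (Suc n) s) =
        (\<lambda>x. (if Suc n \<in> x then 1 else 0) * (\<lambda>x. indicator_vec s (x - {Suc n})) x)"
      using ns by (auto simp: indicator_vec_def fun_eq_iff)
    have "fock b (indicator_vec s) = A0"
    proof
      fix x
      show "fock b (indicator_vec s) x = A0 x"
        unfolding A0_def \<Phi>_def fock_remove[OF b]
        by (subst d0, subst fock_invariant_factor) (simp_all add: inv)
    qed
    moreover have "fock b (indicator_vec (insert (Suc n) s)) = A1"
    proof
      fix x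
      show "fock b (indicator_vec (insert (Suc n) s)) x = A1 x"
        unfolding A1_def \<Phi>_def fock_remove[OF b]
        by (subst d1, subst fock_invariant_factor) (simp_all add: inv)
    qed
    ultimately have "fock (a @ [(n, c)] @ b) (indicator_vec s) s
        - fock (a @ [(n, c)] @ b) (indicator_vec (insert (Suc n) s)) (insert (Suc n) s) =
      fock a (fock_op n c A0) (s - {Suc n}) - fock a (fock_op n c A1) (insert (Suc n) s)"
      using ns by (simp add: fock_append)
    also have "\<dots> = fock a (\<lambda>x. 1 * fock_op n c A0 (x - {Suc n}) + (-1) * fock_op n c A1 (insert (Suc n) x)) s"
      unfolding fock_remove[OF a] fock_insert[OF a] by (subst fock_linear) simp
    also have "(\<lambda>x. 1 * fock_op n c A0 (x - {Suc n}) + (-1) * fock_op n c A1 (insert (Suc n) x)) =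
      (\<lambda>x. rt * \<Phi> (x - {Suc n}))"
    proof
      fix x
      have "Suc n \<in> swap_site n (x - {Suc n}) \<longleftrightarrow> n \<in> x" "Suc n \<in> swap_site n (insert (Suc n) x) \<longleftrightarrow> n \<in> x"
        by (auto simp: swap_site_def)
      then show "1 * fock_op n c A0 (x - {Suc n}) + (-1) * fock_op n c A1 (insert (Suc n) x) =
          rt * \<Phi> (x - {Suc n})"
        by (cases "n \<in> x") (simp_all add: fock_op_def A0_def A1_def algebra_simps)
    qed
    also have "fock a (\<lambda>x. rt * \<Phi> (x - {Suc n})) s = rt * fock a \<Phi> s"
      using fock_remove[OF a, of \<Phi> s] ns by (simp add: fock_scale)
    finally show ?thesis by (simp add: fock_append \<Phi>_def)
  qed
  show ?thesis
    unfolding open_trace_def sum_Pow_Suc[OF assms(1)] sum_distrib_left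
    by (rule sum.cong) (simp_all add: key[simplified] algebra_simps)
qed

lemma insert_eq_insert_iff_Diff:
  assumes "a \<notin> s"
  shows "insert a x = insert a s \<longleftrightarrow> x - {a} = s"
proof
  assume "insert a x = insert a s"
  then have "insert a x - {a} = insert a s - {a}" by simp
  then show "x - {a} = s" using assms by simp
next
  assume "x - {a} = s"
  then show "insert a x = insert a s" by auto
qed

text \<open>The word acts as the identity on the last strand, whose supertrace is 1 - 1 = 0.\<close>

lemma open_trace_split:
  assumes "1 \<le> n" and a: "set a \<subseteq> braid_letters n"
  shows "open_trace (Suc n) a = 0"
proof -
  have "fock a (indicator_vec s) s - fock a (indicator_vec (insert (Suc n) s)) (insert (Suc n) s) = 0"
    if s: "s \<in> Pow {2..n}" for s
  proof -
    have ns: "Suc n \<notin> s" using s by auto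
    have inv: "Suc n \<in> swap_site i x \<longleftrightarrow> Suc n \<in> x" if "(i, c) \<in> set a" for i c x
      using that a by (auto simp: braid_letters_def swap_site_def)
    have d0: "indicator_vec s =
        (\<lambda>x. (if Suc n \<in> x then 0 else 1) * (\<lambda>x. indicator_vec s (x - {Suc n})) x)"
      using ns by (auto simp: indicator_vec_def fun_eq_iff)
    have "insert (Suc n) x = insert (Suc n) s \<longleftrightarrow> x - {Suc n} = s" for x
      using ns by (rule insert_eq_insert_iff_Diff)
    then have d1: "(\<lambda>x. indicator_vec (insert (Suc n) s) (insert (Suc n) x)) =
        (\<lambda>x. indicator_vec s (x - {Suc n}))"
      by (simp add: indicator_vec_def fun_eq_iff)
    have "fock a (indicator_vec s) s = fock a (\<lambda>x. indicator_vec s (x - {Suc n})) s"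
      by (subst d0, subst fock_invariant_factor) (simp_all add: inv ns)
    then show ?thesis
      unfolding fock_insert[OF a] d1 by simp
  qed
  then show ?thesis
    unfolding open_trace_def sum_Pow_Suc[OF assms(1)] by (intro sum.neutral ballI) (simp only: mult_zero_right)
qed

text \<open>The power of \<open>irt\<close> compensates the factor \<open>rt\<close> produced by
  each of the n - 1 stabilizations.\<close>

definition alexander_trace :: "nat \<Rightarrow> (nat \<times> laurent) list \<Rightarrow> laurent" where
  "alexander_trace n w = irt ^ (n - 1) * open_trace n w"

lemma alexander_trace_linear:
  assumes "\<And>\<phi> s. fock x \<phi> s = a * fock y \<phi> s + b * fock y' \<phi> s"
  shows "alexander_trace n (u @ x @ v) =
    a * alexander_trace n (u @ y @ v) + b * alexander_trace n (u @ y' @ v)"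
  by (simp add: alexander_trace_def open_trace_linear[OF assms] algebra_simps)

lemma alexander_trace_cong:
  assumes "\<And>\<phi> s. fock x \<phi> s = fock y \<phi> s"
  shows "alexander_trace n (u @ x @ v) = alexander_trace n (u @ y @ v)"
proof -
  have "fock x \<phi> s = 1 * fock y \<phi> s + 0 * fock y \<phi> s" for \<phi> s
    using assms by simp
  from alexander_trace_linear[OF this, of n u v] show ?thesis by simp
qed

lemma alexander_trace_const:
  "alexander_trace n (u @ [(i, c)] @ v) =
    alexander_trace n (u @ [(i, d)] @ v) + (c - d) * alexander_trace n (u @ v)"
proof -
  have "fock [(i, c)] \<phi> s = 1 * fock [(i, d)] \<phi> s + (c - d) * fock [] \<phi> s" for \<phi> s
    using fock_op_const[of i c \<phi> s] fock_op_const[of i d \<phi> s] by (simp add: algebra_simps)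
  from alexander_trace_linear[OF this, of n u v] show ?thesis by simp
qed

lemma alexander_trace_stabilization:
  assumes "1 \<le> n" "set a \<subseteq> braid_letters n" "set b \<subseteq> braid_letters n"
  shows "alexander_trace (Suc n) (a @ [(n, c)] @ b) = alexander_trace n (a @ b)"
proof -
  have "irt ^ n * rt = irt ^ (n - 1)"
    using assms(1) by (cases n) (simp_all add: mult.assoc power_Suc2 del: power_Suc)
  then show ?thesis
    by (simp add: alexander_trace_def open_trace_stabilization[OF assms, simplified] flip: mult.assoc)
qed

lemma alexander_trace_split:
  assumes "1 \<le> n" "set a \<subseteq> braid_letters n"
  shows "alexander_trace (Suc n) a = 0"
  by (simp add: alexander_trace_def open_trace_split[OF assms])

lemma alexander_trace_unit [simp]: "alexander_trace (Suc 0) [] = 1"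
  by (simp add: alexander_trace_def open_trace_def indicator_vec_def)

lemma alexander_trace_markov_family:
  "markov_family (rt - irt) (\<lambda>n x. alexander_trace n (map (\<lambda>i. (i, 0)) x))"
    (is "markov_family ?z ?F")
proof -
  have lett: "set (map (\<lambda>i. (i, 0::laurent)) u) \<subseteq> braid_letters n" if "set u \<subseteq> {1..<n}" for u n
    using that by (auto simp: braid_letters_def)
  have "hecke_functional ?z n (?F n)" for n
    unfolding hecke_functional_def
  proof (intro conjI allI impI; elim conjE)
    fix u v i
    have "fock [(i, 0), (i, 0)] \<phi> s = 1 * fock [] \<phi> s + ?z * fock [(i, 0)] \<phi> s" for \<phi> s
      by (simp add: fock_op_square)
    from alexander_trace_linear[OF this, of n "map (\<lambda>i. (i, 0)) u" "map (\<lambda>i. (i, 0)) v"]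
    show "?F n (u @ [i, i] @ v) = ?F n (u @ v) + ?z * ?F n (u @ [i] @ v)"
      by simp
  next
    fix u v i
    have "fock [(i, 0), (Suc i, 0), (i, 0)] \<phi> s = fock [(Suc i, 0), (i, 0), (Suc i, 0)] \<phi> s" for \<phi> s
      by (simp add: fock_op_braid)
    from alexander_trace_cong[OF this, of n "map (\<lambda>i. (i, 0)) u" "map (\<lambda>i. (i, 0)) v"]
    show "?F n (u @ [i, Suc i, i] @ v) = ?F n (u @ [Suc i, i, Suc i] @ v)"
      by simp
  next
    fix u v and i j :: nat assume ij: "i + 2 \<le> j"
    have "fock [(i, 0), (j, 0)] \<phi> s = fock [(j, 0), (i, 0)] \<phi> s" for \<phi> s
      using fock_op_commute[OF ij] by simp
    from alexander_trace_cong[OF this, of n "map (\<lambda>i. (i, 0)) u" "map (\<lambda>i. (i, 0)) v"]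
    show "?F n (u @ [i, j] @ v) = ?F n (u @ [j, i] @ v)"
      by simp
  qed
  moreover have "?F (Suc n) (a @ [n] @ b) = ?F n (a @ b)"
    if "1 \<le> n" "set a \<subseteq> {1..<n}" "set b \<subseteq> {1..<n}" for n a b
    using alexander_trace_stabilization[OF that(1) lett[OF that(2)] lett[OF that(3)]] by simp
  moreover have "?F (Suc n) a = 0" if "1 \<le> n" "set a \<subseteq> {1..<n}" for n a
    using alexander_trace_split[OF that(1) lett[OF that(2)]] .
  ultimately show ?thesis
    unfolding markov_family_def by auto
qed

text \<open>The constant for a negative letter comes from the quadratic relation: sigma_i^(-1) =
  sigma_i - (rt - irt).\<close>

definition signed_letter :: "nat \<times> bool \<Rightarrow> nat \<times> laurent" where
  "signed_letter = (\<lambda>(i, c). (i, if c then 0 else irt - rt))"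

theorem alexander_closure:
  assumes \<Delta>: "is_alexander_polynomial \<Delta>" and "1 \<le> n" "set w \<subseteq> braid_letters n"
  shows "\<Delta> (braid_closure n w) = alexander_trace n (map signed_letter w)"
proof -
  \<comment> \<open>The prefix \<open>x\<close> collects the letters already turned positive, so
    that the base case is the uniqueness theorem for positive words. A negative letter is replaced
    by the positive one and by the word without it.\<close>
  have "\<Delta> (braid_closure n (map (\<lambda>i. (i, True)) x @ w)) =
      alexander_trace n (map (\<lambda>i. (i, 0)) x @ map signed_letter w)"
    if "set x \<subseteq> {1..<n}" for x
    using assms(3) that
  proof (induction w arbitrary: x)
    case Nil
    then show ?case
      using markov_family_unique[OF alexander_markov_family[OF \<Delta>] alexander_trace_markov_family] assms(2)
      by simp
  next
    case (Cons y w)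
    obtain i c where y: "y = (i, c)" by (cases y)
    have i: "1 \<le> i" "i < n" and w: "set w \<subseteq> braid_letters n"
      using Cons.prems(1) by (auto simp: y braid_letters_def)
    have pos: "\<Delta> (braid_closure n (map (\<lambda>i. (i, True)) x @ (i, True) # w)) =
        alexander_trace n (map (\<lambda>i. (i, 0)) x @ (i, 0) # map signed_letter w)"
      using Cons.IH[OF w, of "x @ [i]"] i Cons.prems(2) by simp
    show ?case
    proof (cases c)
      case True
      then show ?thesis using pos by (simp add: y signed_letter_def)
    next
      case False
      have "set (map (\<lambda>i. (i, True)) x) \<subseteq> braid_letters n"
        using Cons.prems(2) by (auto simp: braid_letters_def)
      from closure_skein[OF \<Delta> this w i] pos Cons.IH[OF w Cons.prems(2)] False
        alexander_trace_const[of n "map (\<lambda>i. (i, 0)) x" i "irt - rt" "map signed_letter w" 0]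
      show ?thesis by (simp add: y signed_letter_def algebra_simps)
    qed
  qed
  from this[of "[]"] show ?thesis by simp
qed

section \<open>Powers of the product of the projections\<close>

text \<open>Up to a unit, \<open>hecke_word\<close> takes the generators to the spectral projections of
  \<open>\<sigma>\<^sub>i\<^sup>p\<close> (\<open>i\<close> odd) and \<open>\<sigma>\<^sub>i\<^sup>-\<^sup>p\<close> (\<open>i\<close> even) that carry the lowest powers of \<open>t\<close> for large \<open>p\<close>.\<close>

definition hecke_const :: "nat \<Rightarrow> laurent" where
  "hecke_const i = (if odd i then - rt else irt)"

definition hecke_word :: "nat list \<Rightarrow> (nat \<times> laurent) list" where
  "hecke_word = map (\<lambda>i. (i, hecke_const i))"

lemma hecke_word_simps [simp]:
  "hecke_word [] = []" "hecke_word (i # w) = (i, hecke_const i) # hecke_word w"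
  "hecke_word (u @ v) = hecke_word u @ hecke_word v"
  by (simp_all add: hecke_word_def)

lemma set_hecke_word: "set w \<subseteq> {1..<n} \<Longrightarrow> set (hecke_word w) \<subseteq> braid_letters n"
  by (auto simp: hecke_word_def braid_letters_def)

section \<open>Traces of the first two powers by Markov moves\<close>

definition qint :: "nat \<Rightarrow> laurent" where
  "qint n = (\<Sum>i<n. sqrt_t (2 * int i - int n + 1))"

text \<open>The symmetric form t^((1-n)/2) (1 + t + ... + t^(n-1)) obeys the three-term recursion
  that removal of a strand produces for the trace of W^2, up to signs.\<close>

lemma qint_rec: "qint (Suc (Suc n)) = (rt + irt) * qint (Suc n) - qint n"
proof -
  have "irt * qint (Suc n) + sqrt_t (int n + 1) = qint (Suc (Suc n))"
    unfolding qint_def sum_distrib_left sum.lessThan_Suc[of _ "Suc n"]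
    by (simp add: sqrt_t_mult sum_distrib_left algebra_simps)
  moreover have "rt * qint (Suc n) = qint n + sqrt_t (int n + 1)"
    unfolding qint_def sum_distrib_left sum.lessThan_Suc[of _ n]
    by (simp add: sqrt_t_mult sum_distrib_left algebra_simps)
  ultimately show ?thesis by (simp add: algebra_simps)
qed

text \<open>The braid and the square relation leave one generator of the largest index, after which
  stabilization and splitting apply. The coefficient arises as z + 2 a with z = rt - irt; it equals
  a - b by the condition on a + b, which holds for the constants of neighbouring letters
  h_i.\<close>

lemma alexander_trace_double_last:
  assumes n: "1 \<le> n" and U: "set U \<subseteq> braid_letters (Suc n)"
    and ab: "a + b = irt - rt"
  shows "alexander_trace (Suc (Suc n)) (U @ [(Suc n, a), (n, b), (Suc n, a)]) =
    (a - b) * alexander_trace (Suc n) (U @ [(n, b)]) + alexander_trace (Suc n) U"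
proof -
  let ?F = "\<lambda>w. alexander_trace (Suc (Suc n)) (U @ w)" and ?f = "\<lambda>w. alexander_trace (Suc n) (U @ w)"
  let ?x = "(n, 0)" and ?y = "(Suc n, 0)" and ?g = "(n, b)" and ?h = "(Suc n, a)"
  let ?z = "rt - irt"
  have z: "?z = - (a + b)" using ab by simp
  have x: "set (U @ [?x]) \<subseteq> braid_letters (Suc n)" "set [?x] \<subseteq> braid_letters (Suc n)"
    "set (U @ [?x, ?x]) \<subseteq> braid_letters (Suc n)"
    using U n by (auto simp: braid_letters_def)
  note const = alexander_trace_const[of "Suc (Suc n)" _ _ _ _ 0]
  have e1: "?F [?h, ?g, ?h] = ?F [?h, ?x, ?h] + b * ?F [?h, ?h]"
    using const[of "U @ [?h]" n b "[?h]"] by simp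
  have e2: "?F [?h, ?x, ?h] = ?F [?y, ?x, ?h] + a * ?F [?x, ?h]"
    using const[of U "Suc n" a "[?x, ?h]"] by simp
  have e3: "?F [?y, ?x, ?h] = ?F [?y, ?x, ?y] + a * ?F [?y, ?x]"
    using const[of "U @ [?y, ?x]" "Suc n" a "[]"] by simp
  have e4: "?F [?x, ?h] = ?F [?x, ?y] + a * ?F [?x]"
    using const[of "U @ [?x]" "Suc n" a "[]"] by simp
  have e5: "?F [?h, ?h] = ?F [?y, ?h] + a * ?F [?h]"
    using const[of U "Suc n" a "[?h]"] by simp
  have e6: "?F [?y, ?h] = ?F [?y, ?y] + a * ?F [?y]"
    using const[of "U @ [?y]" "Suc n" a "[]"] by simp
  have e7: "?F [?h] = ?F [?y] + a * ?F []"
    using const[of U "Suc n" a "[]"] by simp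
  have "fock [(i, 0), (i, 0)] \<phi> s = 1 * fock [] \<phi> s + ?z * fock [(i, 0)] \<phi> s" for i \<phi> s
    by (simp add: fock_op_square)
  note square = alexander_trace_linear[OF this, of _ U _ "[]"]
  have e8: "?F [?y, ?y] = ?F [] + ?z * ?F [?y]"
    using square[of "Suc (Suc n)" "Suc n"] by simp
  have "fock [?y, ?x, ?y] \<phi> s = fock [?x, ?y, ?x] \<phi> s" for \<phi> s
    by (simp add: fock_op_braid)
  from alexander_trace_cong[OF this, of _ U "[]"]
  have e9: "?F [?y, ?x, ?y] = ?F [?x, ?y, ?x]"
    by simp
  have s1: "?F [?x, ?y, ?x] = ?f [?x, ?x]"
    using alexander_trace_stabilization[OF _ x(1,2), of 0] by simp
  have s2: "?F [?y, ?x] = ?f [?x]"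
    using alexander_trace_stabilization[OF _ U x(2), of 0] by simp
  have s3: "?F [?x, ?y] = ?f [?x]"
    using alexander_trace_stabilization[OF _ x(1), of "[]" 0] by simp
  have s4: "?F [?x] = 0" "?F [] = 0"
    using alexander_trace_split[OF _ x(1)] alexander_trace_split[OF _ U] by simp_all
  have s5: "?F [?y] = ?f []"
    using alexander_trace_stabilization[OF _ U, of "[]" 0] by simp
  have t1: "?f [?x, ?x] = ?f [] + ?z * ?f [?x]"
    using square[of "Suc n" n] by simp
  have t2: "?f [?g] = ?f [?x] + b * ?f []"
    using alexander_trace_const[of "Suc n" U n b "[]" 0] by simp
  have "?F [?h, ?g, ?h] = (a - b) * ?f [?g] + ?f []"
    unfolding e1 e2 e3 e4 e5 e6 e7 e8 e9 s1 s2 s3 s4 s5 t1 t2 z by (simp add: algebra_simps)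
  then show ?thesis by simp
qed

lemma alexander_trace_hecke_word_upt:
  "1 \<le> n \<Longrightarrow> alexander_trace n (hecke_word [1..<n]) = 1"
proof (induction n rule: nat_induct_at_least)
  case (Suc n)
  then show ?case
    using alexander_trace_stabilization[of n "hecke_word [1..<n]" "[]" "hecke_const n"]
      set_hecke_word[of "[1..<n]" n] by simp
qed simp

lemma fock_commute_letter:
  assumes "\<And>j d. (j, d) \<in> set v \<Longrightarrow> i + 2 \<le> j \<or> j + 2 \<le> i"
  shows "fock ((i, c) # v) \<phi> = fock (v @ [(i, c)]) \<phi>"
  using assms
proof (induction v)
  case (Cons x v)
  obtain j d where x: "x = (j, d)" by (cases x)
  have "i + 2 \<le> j \<or> j + 2 \<le> i" using Cons.prems[of j d] x by simp
  then have "fock_op i c (fock_op j d (fock v \<phi>)) = fock_op j d (fock_op i c (fock v \<phi>))"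
    using fock_op_commute[of i j c d "fock v \<phi>"] fock_op_commute[of j i d c "fock v \<phi>"] by auto
  moreover have "fock ((i, c) # v) \<phi> = fock (v @ [(i, c)]) \<phi>"
    by (rule Cons.IH, rule Cons.prems) auto
  ultimately show ?case by (simp add: x)
qed simp

lemma fock_commute:
  assumes "\<And>i c j d. (i, c) \<in> set u \<Longrightarrow> (j, d) \<in> set v \<Longrightarrow> i + 2 \<le> j \<or> j + 2 \<le> i"
  shows "fock (u @ v) \<phi> = fock (v @ u) \<phi>"
  using assms
proof (induction u)
  case (Cons x u)
  obtain i c where x: "x = (i, c)" by (cases x)
  have "fock (u @ v) \<phi> = fock (v @ u) \<phi>"
    by (rule Cons.IH, rule Cons.prems) auto
  moreover have "fock ((i, c) # v) (fock u \<phi>) = fock (v @ [(i, c)]) (fock u \<phi>)"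
    by (rule fock_commute_letter) (use Cons.prems x in auto)
  ultimately show ?case by (simp add: x fock_append)
qed simp

lemma alexander_trace_double_hecke_word:
  "1 \<le> n \<Longrightarrow> alexander_trace n (hecke_word [1..<n] @ hecke_word [1..<n]) = (-1) ^ (n div 2) * qint n"
proof (induction n rule: less_induct)
  case (less n)
  consider "n = 1" | "n = 2" | k where "n = Suc (Suc k)" "1 \<le> k"
    using less.prems by (metis One_nat_def Suc_1 Suc_leI le_SucE not0_implies_Suc not_less_eq_eq zero_less_iff_neq_zero)
  then show ?case
  proof cases
    case 1
    then show ?thesis by (simp add: qint_def)
  next
    case 2
    let ?y = "(1::nat, 0::laurent)" and ?h = "(1::nat, - rt)"
    have h: "alexander_trace 2 [?h, ?h] = alexander_trace 2 [?y, ?h] - rt * alexander_trace 2 [?h]"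
      using alexander_trace_const[of 2 "[]" 1 "- rt" "[?h]" 0] by simp
    have h': "alexander_trace 2 [?y, ?h] = alexander_trace 2 [?y, ?y] - rt * alexander_trace 2 [?y]"
      using alexander_trace_const[of 2 "[?y]" 1 "- rt" "[]" 0] by simp
    have "fock [?y, ?y] \<phi> s = 1 * fock [] \<phi> s + (rt - irt) * fock [?y] \<phi> s" for \<phi> s
      by (simp add: fock_op_square)
    from alexander_trace_linear[OF this, of 2 "[]" "[]"]
    have yy: "alexander_trace 2 [?y, ?y] = alexander_trace 2 [] + (rt - irt) * alexander_trace 2 [?y]"
      by simp
    have one: "alexander_trace 2 [(1, c)] = 1" for c
      using alexander_trace_stabilization[of 1 "[]" "[]" c] by (simp add: numeral_2_eq_2)
    have zero: "alexander_trace 2 [] = 0"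
      using alexander_trace_split[of 1 "[]"] by (simp add: numeral_2_eq_2)
    have "alexander_trace 2 [?h, ?h] = - (rt + irt)"
      unfolding h h' yy one zero by simp
    then show ?thesis
      using 2 by (simp add: qint_def hecke_const_def numeral_2_eq_2 upt_rec)
  next
    case 3
    let ?X = "hecke_word [1..<k]" and ?g = "(k, hecke_const k)" and ?h = "(Suc k, hecke_const (Suc k))"
    have X: "set ?X \<subseteq> braid_letters k"
      by (rule set_hecke_word) simp
    then have U: "set (?X @ ?g # ?X) \<subseteq> braid_letters (Suc k)"
      using 3 by (auto simp: braid_letters_def)
    have up: "hecke_word [1..<n] = ?X @ [?g, ?h]" "hecke_word [1..<Suc k] = ?X @ [?g]"
      using 3 by simp_all
    \<comment> \<open>The square is X g h X g h. As h commutes with X, its end becomes the h g h of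
      \<open>alexander_trace_double_last\<close>.\<close>
    have "fock (?h # ?X) \<phi> = fock (?X @ [?h]) \<phi>" for \<phi>
      by (rule fock_commute_letter) (use X in \<open>auto simp: braid_letters_def\<close>)
    then have "alexander_trace n ((?X @ [?g]) @ (?h # ?X) @ [?g, ?h]) =
        alexander_trace n ((?X @ [?g]) @ (?X @ [?h]) @ [?g, ?h])"
      by (intro alexander_trace_cong) simp
    then have "alexander_trace n (hecke_word [1..<n] @ hecke_word [1..<n]) =
        alexander_trace n ((?X @ ?g # ?X) @ [?h, ?g, ?h])"
      unfolding up(1) by simp
    also have "\<dots> = (hecke_const (Suc k) - hecke_const k) * alexander_trace (Suc k) ((?X @ ?g # ?X) @ [?g])
        + alexander_trace (Suc k) (?X @ ?g # ?X)"
      unfolding 3(1) by (rule alexander_trace_double_last[OF 3(2) U]) (simp add: hecke_const_def)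
    also have "alexander_trace (Suc k) (?X @ ?g # ?X) = alexander_trace k (?X @ ?X)"
      using alexander_trace_stabilization[OF 3(2) X X] by simp
    also have "\<dots> = (-1) ^ (k div 2) * qint k"
      using less.IH[of k] 3 by simp
    also have "alexander_trace (Suc k) ((?X @ ?g # ?X) @ [?g]) = (-1) ^ (Suc k div 2) * qint (Suc k)"
      using less.IH[of "Suc k"] 3 by (simp add: up(2))
    finally show ?thesis
      \<comment> \<open>The difference of the two constants is rt + irt for odd k and its negative
        for even k; the signs (-1)^(n div 2) turn both cases into \<open>qint_rec\<close>.\<close>
      by (cases "even k") (simp_all add: 3(1) qint_rec hecke_const_def algebra_simps)
  qed
qed

section \<open>Cyclicity and rearrangement of the powers\<close>

lemma fock_cong_invariant:
  assumes "\<And>i c s. (i, c) \<in> set w \<Longrightarrow> Q s \<Longrightarrow> Q (swap_site i s)"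
    and "\<And>s. Q s \<Longrightarrow> \<phi> s = \<psi> s" and "Q s"
  shows "fock w \<phi> s = fock w \<psi> s"
  using assms(1,3)
proof (induction w arbitrary: s)
  case Nil
  then show ?case using assms(2) by simp
next
  case (Cons x w)
  obtain i c where x: "x = (i, c)" by (cases x)
  have "Q (swap_site i s)" using Cons.prems(1)[of i c s] Cons.prems(2) x by simp
  moreover have "fock w \<phi> r = fock w \<psi> r" if "Q r" for r
    by (rule Cons.IH[OF _ that], rule Cons.prems) auto
  ultimately show ?case using Cons.prems(2) by (simp add: x fock_op_def)
qed

lemma fock_kernel:
  assumes "set w \<subseteq> braid_letters n" "s \<in> Pow {1..n}"
  shows "fock w \<phi> s = (\<Sum>r\<in>Pow {1..n}. fock w (indicator_vec r) s * \<phi> r)"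
  using assms
proof (induction w arbitrary: s)
  case Nil
  have "(\<Sum>r\<in>Pow {1..n}. fock [] (indicator_vec r) s * \<phi> r) = (\<Sum>r\<in>Pow {1..n}. if s = r then \<phi> r else 0)"
    by (intro sum.cong) (simp_all add: indicator_vec_def)
  then show ?case using Nil by simp
next
  case (Cons x w)
  obtain i c where x: "x = (i, c)" by (cases x)
  have "swap_site i s \<in> Pow {1..n}"
    using Cons.prems x swap_site_subset[of i n s] by (auto simp: braid_letters_def)
  then show ?case
    using Cons by (simp add: x fock_op_def sum_distrib_left sum.distrib algebra_simps)
qed

text \<open>Words conserve the number of particles, and letters from 2 on do not touch site
  1.\<close>

lemma fock_kernel_support:
  assumes "set w \<subseteq> {2..} \<times> UNIV" "fock w (indicator_vec r) s \<noteq> 0"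
  shows "card r = card s" "1 \<in> r \<longleftrightarrow> 1 \<in> s"
proof -
  let ?Q = "\<lambda>x :: nat set. card x = card s \<and> (1 \<in> x \<longleftrightarrow> 1 \<in> s)"
  have "?Q r"
  proof (rule ccontr)
    assume "\<not> ?Q r"
    have "fock w (indicator_vec r) s = fock w (\<lambda>_. 0) s"
    proof (rule fock_cong_invariant[where Q = ?Q])
      fix i c x assume "(i, c) \<in> set w" "?Q x"
      moreover from this have "1 \<in> swap_site i x \<longleftrightarrow> 1 \<in> x"
        using assms(1) by (auto simp: swap_site_def)
      ultimately show "?Q (swap_site i x)" by simp
    next
      fix x assume "?Q x"
      with \<open>\<not> ?Q r\<close> show "indicator_vec r x = 0" by (auto simp: indicator_vec_def)
    qed simp
    then show False using assms(2) by (simp add: fock_zero)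
  qed
  then show "card r = card s" "1 \<in> r \<longleftrightarrow> 1 \<in> s" by simp_all
qed

text \<open>Composition runs through all intermediate states, while the trace has only those with
  site 1 empty. Since \<open>v\<close> preserves the occupation of site 1, the other intermediate
  states drop out; since it preserves the particle number, the sign can be read off either
  state.\<close>

lemma open_trace_cyclic:
  assumes u: "set u \<subseteq> braid_letters n" and v: "set v \<subseteq> braid_letters n"
    and v2: "set v \<subseteq> {2..} \<times> UNIV"
  shows "open_trace n (u @ v) = open_trace n (v @ u)"
proof -
  define K where "K w r s = fock w (indicator_vec r) s" for w r s
  have sub: "Pow {2..n} \<subseteq> Pow {1..n}" by auto
  have out: "1 \<in> r" if "r \<in> Pow {1..n} - Pow {2..n}" for r :: "nat set"
  proof -
    from that obtain x where "x \<in> r" "x \<notin> {2..n}" by blast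
    moreover from this that have "x \<in> {1..n}" by blast
    ultimately have "x = 1" by auto
    then show ?thesis using \<open>x \<in> r\<close> by simp
  qed
  have nin: "1 \<notin> s" if "s \<in> Pow {2..n}" for s :: "nat set" using that by auto
  have uv: "fock (u @ v) (indicator_vec s) s = (\<Sum>r\<in>Pow {2..n}. K u r s * K v s r)"
    if s: "s \<in> Pow {2..n}" for s
  proof -
    have "fock (u @ v) (indicator_vec s) s = (\<Sum>r\<in>Pow {1..n}. K u r s * K v s r)"
      using fock_kernel[OF u, of s "fock v (indicator_vec s)"] s sub by (auto simp: fock_append K_def)
    also have "\<dots> = (\<Sum>r\<in>Pow {2..n}. K u r s * K v s r)"
    proof (rule sum.mono_neutral_right)
      show "\<forall>r\<in>Pow {1..n} - Pow {2..n}. K u r s * K v s r = 0"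
        using fock_kernel_support(2)[OF v2] out nin[OF s] unfolding K_def by (metis mult_zero_left mult_zero_right)
    qed (use sub in auto)
    finally show ?thesis .
  qed
  have vu: "fock (v @ u) (indicator_vec s) s = (\<Sum>r\<in>Pow {2..n}. K v r s * K u s r)"
    if s: "s \<in> Pow {2..n}" for s
  proof -
    have "fock (v @ u) (indicator_vec s) s = (\<Sum>r\<in>Pow {1..n}. K v r s * K u s r)"
      using fock_kernel[OF v, of s "fock u (indicator_vec s)"] s sub by (auto simp: fock_append K_def)
    also have "\<dots> = (\<Sum>r\<in>Pow {2..n}. K v r s * K u s r)"
    proof (rule sum.mono_neutral_right)
      show "\<forall>r\<in>Pow {1..n} - Pow {2..n}. K v r s * K u s r = 0"
        using fock_kernel_support(2)[OF v2] out nin[OF s] unfolding K_def by (metis mult_zero_left mult_zero_right)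
    qed (use sub in auto)
    finally show ?thesis .
  qed
  have "open_trace n (u @ v) = (\<Sum>s\<in>Pow {2..n}. \<Sum>r\<in>Pow {2..n}. (-1) ^ card s * (K u r s * K v s r))"
    unfolding open_trace_def by (intro sum.cong) (simp_all add: uv sum_distrib_left)
  also have "\<dots> = (\<Sum>s\<in>Pow {2..n}. \<Sum>r\<in>Pow {2..n}. (-1) ^ card r * (K v s r * K u r s))"
  proof (intro sum.cong refl)
    fix s r
    show "(-1) ^ card s * (K u r s * K v s r) = (-1) ^ card r * (K v s r * K u r s)"
      using fock_kernel_support(1)[OF v2, of s r] unfolding K_def
      by (cases "fock v (indicator_vec s) r = 0") (simp_all add: mult.commute)
  qed
  also have "\<dots> = (\<Sum>r\<in>Pow {2..n}. \<Sum>s\<in>Pow {2..n}. (-1) ^ card r * (K v s r * K u r s))"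
    by (rule sum.swap)
  also have "\<dots> = open_trace n (v @ u)"
    unfolding open_trace_def by (intro sum.cong) (simp_all add: vu sum_distrib_left)
  finally show ?thesis .
qed

lemma open_trace_power_rotate:
  assumes u: "set u \<subseteq> braid_letters n" and v: "set v \<subseteq> braid_letters n"
    and v2: "set v \<subseteq> {2..} \<times> UNIV"
  shows "open_trace n (concat (replicate m (u @ v))) = open_trace n (concat (replicate m (v @ u)))"
proof (cases m)
  case (Suc k)
  have rot: "concat (replicate (Suc k) (u @ v)) = (u @ concat (replicate k (v @ u))) @ v" for k
    by (induction k) auto
  have "set (concat (replicate k (v @ u))) \<subseteq> braid_letters n"
    using u v by auto
  then have "open_trace n ((u @ concat (replicate k (v @ u))) @ v) =
      open_trace n (v @ u @ concat (replicate k (v @ u)))"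
    using u by (intro open_trace_cyclic v v2) auto
  then show ?thesis unfolding Suc rot by simp
qed simp

lemma fock_power_cong:
  assumes "\<And>\<phi>. fock w \<phi> = fock w' \<phi>"
  shows "fock (concat (replicate m w)) \<phi> = fock (concat (replicate m w')) \<phi>"
  using assms by (induction m) (simp_all add: fock_append)

lemma open_trace_power_cong:
  assumes "\<And>\<phi>. fock w \<phi> = fock w' \<phi>"
  shows "open_trace n (concat (replicate m w)) = open_trace n (concat (replicate m w'))"
  unfolding open_trace_def fock_power_cong[OF assms] ..

lemma open_trace_power_odd_even:
  assumes "2 \<le> n"
  shows "\<exists>E. set E = {i. even i \<and> 2 \<le> i \<and> i < n} \<and> distinct E \<and>
    (\<forall>m. open_trace n (concat (replicate m (hecke_word [1..<n]))) =
      open_trace n (concat (replicate m (hecke_word (filter odd [1..<n] @ E)))))"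
proof -
  \<comment> \<open>After k - 1 rounds the odd letters below 2k stand in front and the even ones at
    the end. One more round moves the block B of all letters above 2k past E, rotates it to the
    front and moves it past the odd letters, which puts 2k + 1 before 2k. The block never contains
    the letter 1, as the rotation demands.\<close>
  have claim: "\<exists>E. set E = {i. even i \<and> 2 \<le> i \<and> i < 2 * k} \<and> distinct E \<and>
    (\<forall>m. open_trace n (concat (replicate m (hecke_word [1..<n]))) =
      open_trace n (concat (replicate m (hecke_word (filter odd [1..<2 * k] @ [2 * k..<n] @ E)))))"
    if "1 \<le> k" "2 * k \<le> n" for k
    using that
  proof (induction k rule: nat_induct_at_least)
    case base
    have "[1..<n] = filter odd [1..<2 * 1] @ [2 * 1..<n] @ []"
      using assms upt_conv_Cons[of 1 n] by (simp add: numeral_2_eq_2)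
    then show ?case by (intro exI[of _ "[]"]) auto
  next
    case (Suc k)
    then have "2 * k \<le> n" by simp
    with Suc.IH obtain E where E: "set E = {i. even i \<and> 2 \<le> i \<and> i < 2 * k}" "distinct E"
      and tr: "\<And>m. open_trace n (concat (replicate m (hecke_word [1..<n]))) =
        open_trace n (concat (replicate m (hecke_word (filter odd [1..<2 * k] @ [2 * k..<n] @ E))))"
      by blast
    let ?O = "hecke_word (filter odd [1..<2 * k])" and ?B = "hecke_word [Suc (2 * k)..<n]"
      and ?d = "(2 * k, hecke_const (2 * k))" and ?E = "hecke_word E"
    have upt: "[2 * k..<n] = 2 * k # [Suc (2 * k)..<n]" "[Suc (2 * k)..<n] = Suc (2 * k) # [2 * Suc k..<n]"
      using Suc.prems by (simp_all add: upt_conv_Cons)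
    have odds: "filter odd [1..<2 * Suc k] = filter odd [1..<2 * k] @ [Suc (2 * k)]"
      using Suc.hyps by simp
    have set': "set (2 * k # E) = {i. even i \<and> 2 \<le> i \<and> i < 2 * Suc k}"
    proof -
      have "even i \<and> 2 \<le> i \<and> i < 2 * Suc k \<longleftrightarrow> i = 2 * k \<or> even i \<and> 2 \<le> i \<and> i < 2 * k" for i
        using Suc.hyps by presburger
      then show ?thesis unfolding list.set E(1) by blast
    qed
    have "set (filter odd [1..<2 * k] @ 2 * k # E) \<subseteq> {1..<n}"
      using Suc.hyps Suc.prems by (simp add: E(1) subset_iff)
    then have letters: "set (?O @ ?d # ?E) \<subseteq> braid_letters n" "set ?B \<subseteq> braid_letters n"
      using set_hecke_word[of "filter odd [1..<2 * k] @ 2 * k # E" n]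
        set_hecke_word[of "[Suc (2 * k)..<n]" n] by simp_all
    have EB: "fock (?B @ ?E) \<phi> = fock (?E @ ?B) \<phi>" for \<phi>
    proof (rule fock_commute)
      fix i c j d assume "(i, c) \<in> set ?B" "(j, d) \<in> set ?E"
      then have "i \<in> set [Suc (2 * k)..<n]" "j \<in> set E"
        by (auto simp: hecke_word_def simp del: set_upt)
      then have "2 * k < i" "even j" "j < 2 * k"
        unfolding E(1) by simp_all
      then show "i + 2 \<le> j \<or> j + 2 \<le> i" by presburger
    qed
    have OB: "fock (?B @ ?O) \<phi> = fock (?O @ ?B) \<phi>" for \<phi>
    proof (rule fock_commute)
      fix i c j d assume "(i, c) \<in> set ?B" "(j, d) \<in> set ?O"
      then have "i \<in> set [Suc (2 * k)..<n]" "j \<in> set (filter odd [1..<2 * k])"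
        by (auto simp: hecke_word_def simp del: set_upt)
      then have "2 * k < i" "odd j" "j < 2 * k"
        by simp_all
      then show "i + 2 \<le> j \<or> j + 2 \<le> i" by presburger
    qed
    have "open_trace n (concat (replicate m (hecke_word [1..<n]))) =
        open_trace n (concat (replicate m (hecke_word (filter odd [1..<2 * Suc k] @ [2 * Suc k..<n] @ (2 * k # E)))))"
      for m
    proof -
      have "open_trace n (concat (replicate m (hecke_word [1..<n]))) =
          open_trace n (concat (replicate m (?O @ ?d # ?B @ ?E)))"
        unfolding tr upt(1) by simp
      also have "\<dots> = open_trace n (concat (replicate m ((?O @ ?d # ?E) @ ?B)))"
        by (rule open_trace_power_cong) (use EB in \<open>simp add: fock_append\<close>)
      also have "\<dots> = open_trace n (concat (replicate m (?B @ (?O @ ?d # ?E))))"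
      proof (rule open_trace_power_rotate[OF letters])
        show "set ?B \<subseteq> {2..} \<times> UNIV" using Suc.hyps by (auto simp: hecke_word_def)
      qed
      also have "\<dots> = open_trace n (concat (replicate m (?O @ ?B @ ?d # ?E)))"
        by (rule open_trace_power_cong) (use OB in \<open>simp add: fock_append\<close>)
      finally show ?thesis
        unfolding odds by (simp add: upt(2))
    qed
    then show ?case
      using set' E by (intro exI[of _ "2 * k # E"] conjI allI) simp_all
  qed
  obtain k where k: "1 \<le> k" "2 * k \<le> n" "n = 2 * k \<or> n = Suc (2 * k)"
    using that[of "n div 2"] assms by linarith
  from claim[OF k(1,2)] obtain E where E: "set E = {i. even i \<and> 2 \<le> i \<and> i < 2 * k}" "distinct E"
    and tr: "\<forall>m. open_trace n (concat (replicate m (hecke_word [1..<n]))) =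
      open_trace n (concat (replicate m (hecke_word (filter odd [1..<2 * k] @ [2 * k..<n] @ E))))"
    by (elim exE conjE)
  \<comment> \<open>The remaining tail is empty for n = 2k; for n = 2k + 1 it is the single even
    letter 2k.\<close>
  define E' where "E' = (if n = 2 * k then E else 2 * k # E)"
  have "filter odd [1..<2 * k] @ [2 * k..<n] @ E = filter odd [1..<n] @ E'"
    using k by (auto simp: E'_def)
  moreover have "set E' = {i. even i \<and> 2 \<le> i \<and> i < n}"
    using k by (auto simp: E'_def E(1) less_Suc_eq)
  moreover have "distinct E'"
    using E by (simp add: E'_def)
  ultimately show ?thesis
    using tr by (intro exI[of _ E'] conjI) (simp_all only: simp_thms)
qed

section \<open>Ranks of the odd and even projections\<close>

lemma fock_odd_letter_empty:
  assumes "i \<notin> s" "Suc i \<notin> s"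
  shows "fock_op i (- rt) \<phi> s = 0"
  using assms by (simp add: fock_op_def)

text \<open>On a pair with one particle, sigma_i - rt has rank one: its image is the eigenline for -
  irt, so one amplitude fixes the other.\<close>

lemma fock_odd_letter_right:
  assumes "i \<notin> s" "Suc i \<in> s"
  shows "fock_op i (- rt) \<phi> s = - rt * fock_op i (- rt) \<phi> (swap_site i s)"
proof -
  have "i \<in> swap_site i s" "Suc i \<notin> swap_site i s"
    using assms by (simp_all add: swap_site_def)
  then show ?thesis
    using assms by (simp add: fock_op_def algebra_simps)
qed

text \<open>A full pair has the eigenvalue - irt. The initial state is the one tested here, because
  the even letters will act first.\<close>

lemma fock_even_letter_full:
  assumes "i \<in> s" "Suc i \<in> s"
  shows "fock_op i irt (indicator_vec s) x = 0"
proof -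
  have "swap_site i x \<noteq> s" if "\<not> (i \<in> x \<longleftrightarrow> Suc i \<in> x)"
  proof
    assume "swap_site i x = s"
    then have "i \<in> swap_site i x" "Suc i \<in> swap_site i x" using assms by simp_all
    then show False using that by (simp add: swap_site_def)
  qed
  then show ?thesis using assms by (auto simp: fock_op_def indicator_vec_def)
qed

text \<open>The local conditions that the odd letters impose on their image: no odd pair is empty,
  and the amplitudes for a single particle in a pair are proportional.\<close>

definition odd_projected :: "nat \<Rightarrow> (nat set \<Rightarrow> laurent) \<Rightarrow> bool" where
  "odd_projected n \<psi> \<longleftrightarrow> (\<forall>i s. odd i \<and> i < n \<and> s \<subseteq> {1..n} \<and> i \<notin> s \<longrightarrow>
    (if Suc i \<in> s then \<psi> s = - rt * \<psi> (swap_site i s) else \<psi> s = 0))"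

text \<open>The odd letters commute, so each of them can be made the last one to act and then
  imposes its condition.\<close>

lemma odd_projected_fock:
  "odd_projected n (fock (hecke_word (filter odd [1..<n])) \<phi>)"
  unfolding odd_projected_def
proof (intro allI impI; elim conjE)
  fix i s assume i: "odd i" "i < n" "i \<notin> s" "s \<subseteq> {1..n}"
  then have "1 \<le> i" by (simp add: odd_pos Suc_leI)
  let ?u = "filter odd [1..<i]" and ?v = "filter odd [Suc i..<n]"
  have "[1..<n] = [1..<i] @ i # [Suc i..<n]"
    using i(2) upt_add_eq_append[OF \<open>1 \<le> i\<close>, of "n - i"] upt_conv_Cons[OF i(2)] by simp
  then have split: "hecke_word (filter odd [1..<n]) = hecke_word ?u @ (i, - rt) # hecke_word ?v"
    using i by (simp add: hecke_const_def)
  have "fock ((i, - rt) # hecke_word ?u) \<psi> = fock (hecke_word ?u @ [(i, - rt)]) \<psi>" for \<psi>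
  proof (rule fock_commute_letter)
    fix j d assume "(j, d) \<in> set (hecke_word ?u)"
    then have "j \<in> set ?u" by (auto simp: hecke_word_def)
    then have "odd j" "j < i" by simp_all
    then show "i + 2 \<le> j \<or> j + 2 \<le> i" using i(1) by presburger
  qed
  then have "fock (hecke_word (filter odd [1..<n])) \<phi> =
      fock_op i (- rt) (fock (hecke_word ?u) (fock (hecke_word ?v) \<phi>))"
    unfolding split by (simp add: fock_append)
  then show "if Suc i \<in> s
     then fock (hecke_word (filter odd [1..<n])) \<phi> s =
       - rt * fock (hecke_word (filter odd [1..<n])) \<phi> (swap_site i s)
     else fock (hecke_word (filter odd [1..<n])) \<phi> s = 0"
    using fock_odd_letter_right[OF i(3)] fock_odd_letter_empty[OF i(3)] by simp
qed

definition odd_sites :: "nat \<Rightarrow> nat set" where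
  "odd_sites n = {i. odd i \<and> i < n}"

lemma card_odd_sites: "card (odd_sites n) = n div 2"
proof -
  have "odd_sites n = (\<lambda>k. 2 * k + 1) ` {..<n div 2}"
    by (auto simp: odd_sites_def image_iff elim!: oddE)
  then show ?thesis by (simp add: card_image inj_on_def)
qed

text \<open>Moving the particles of the odd pairs \<open>{i, i + 1}\<close> to the left shows that the odd projector
  has rank one in degree \<open>n div 2\<close> and rank zero below.\<close>

lemma odd_projected_determined:
  assumes "s \<subseteq> {1..n}" "card s \<le> n div 2"
  shows "\<exists>u. (card s < n div 2 \<longrightarrow> u = 0) \<and> (\<forall>\<psi>. odd_projected n \<psi> \<longrightarrow> \<psi> s = \<psi> (odd_sites n) * u)"
  using assms
\<comment> \<open>Moving the particle of an odd pair to the left vacates an even site. When no odd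
  site below n is vacant, the bound on the cardinality forces
  \<open>s = odd_sites n\<close>.\<close>
proof (induction "card {x\<in>s. even x}" arbitrary: s rule: less_induct)
  case less
  have fin: "finite s" using less.prems finite_subset by blast
  show ?case
  proof (cases "odd_sites n \<subseteq> s")
    case True
    then have "odd_sites n = s"
      using fin less.prems by (metis card_odd_sites card_seteq)
    then show ?thesis
      using card_odd_sites by (intro exI[of _ 1]) auto
  next
    case False
    then obtain i where i: "odd i" "i < n" "i \<notin> s" by (auto simp: odd_sites_def)
    then have "1 \<le> i" by (simp add: odd_pos Suc_leI)
    show ?thesis
    proof (cases "Suc i \<in> s")
      case False
      then have "\<psi> s = 0" if "odd_projected n \<psi>" for \<psi>
        using that i less.prems unfolding odd_projected_def by metis
      then show ?thesis by (intro exI[of _ 0]) auto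
    next
      case True
      let ?s = "swap_site i s"
      have evens: "{x\<in>?s. even x} = {x\<in>s. even x} - {Suc i}"
        using i True by (auto simp: swap_site_def)
      have "card {x\<in>?s. even x} < card {x\<in>s. even x}"
        unfolding evens using fin True i(1) by (intro card_Diff1_less) auto
      moreover have "?s \<subseteq> {1..n}" "card ?s \<le> n div 2"
        using swap_site_subset[OF \<open>1 \<le> i\<close> i(2) less.prems(1)] less.prems(2) by simp_all
      ultimately obtain u where u: "card ?s < n div 2 \<longrightarrow> u = 0"
        "\<forall>\<psi>. odd_projected n \<psi> \<longrightarrow> \<psi> ?s = \<psi> (odd_sites n) * u"
        using less.hyps by blast
      have "\<psi> s = \<psi> (odd_sites n) * (- rt * u)" if "odd_projected n \<psi>" for \<psi>
      proof -
        have "\<psi> s = - rt * \<psi> ?s"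
          using that i True less.prems unfolding odd_projected_def by metis
        also have "\<psi> ?s = \<psi> (odd_sites n) * u"
          using u(2) that by blast
        finally show ?thesis by (simp add: algebra_simps)
      qed
      then show ?thesis
        using u(1) by (intro exI[of _ "- rt * u"]) auto
    qed
  qed
qed

text \<open>With site 1 empty, the classes {2j, 2j + 1} split the sites 2, ..., n into n div 2
  classes. By the pigeonhole principle some class is full, and its even letter, brought to act
  first, kills the state.\<close>

lemma fock_even_word_crowded:
  assumes E: "set E = {i. even i \<and> 2 \<le> i \<and> i < n}" "distinct E"
    and s: "s \<in> Pow {2..n}" "n div 2 < card s"
  shows "fock (hecke_word E) (indicator_vec s) = (\<lambda>_. 0)"
proof -
  have "card ((\<lambda>x. x div 2) ` s) \<le> card {1..n div 2}"
  proof (rule card_mono)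
    show "(\<lambda>x. x div 2) ` s \<subseteq> {1..n div 2}"
    proof
      fix y assume "y \<in> (\<lambda>x. x div 2) ` s"
      then obtain x where "y = x div 2" "2 \<le> x" "x \<le> n" using s(1) by auto
      then show "y \<in> {1..n div 2}" by (simp add: div_le_mono Suc_leI)
    qed
  qed simp
  then have "\<not> inj_on (\<lambda>x. x div 2) s"
    using s(2) card_image by fastforce
  then obtain x y where xy: "x \<in> s" "y \<in> s" "x < y" "x div 2 = y div 2"
    using linorder_inj_onI'[of s "\<lambda>x. x div 2"] by blast
  then have "even x" "y = Suc x" by presburger+
  then have x: "x \<in> s" "Suc x \<in> s" "x \<in> set E"
    using xy s(1) E(1) by auto
  then obtain u v where uv: "E = u @ x # v" by (meson split_list)
  have "fock ((x, irt) # hecke_word v) \<psi> = fock (hecke_word v @ [(x, irt)]) \<psi>" for \<psi>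
  proof (rule fock_commute_letter)
    fix j d assume "(j, d) \<in> set (hecke_word v)"
    then have "j \<in> set v" by (auto simp: hecke_word_def)
    then have "j \<in> set E" "j \<noteq> x" using E(2) by (auto simp: uv)
    then have "even j" "j \<noteq> x" using E(1) by auto
    then show "x + 2 \<le> j \<or> j + 2 \<le> x" using \<open>even x\<close> by presburger
  qed
  then have "fock (hecke_word E) (indicator_vec s) =
      fock (hecke_word u @ hecke_word v) (fock_op x irt (indicator_vec s))"
    using \<open>even x\<close> by (simp add: uv fock_append hecke_const_def)
  also have "fock_op x irt (indicator_vec s) = (\<lambda>_. 0)"
    using fock_even_letter_full[OF x(1,2)] by blast
  finally show ?thesis by (simp add: fun_eq_iff fock_zero)
qed

lemma open_trace_power_rank_one:
  assumes E: "set E = {i. even i \<and> 2 \<le> i \<and> i < n}" "distinct E"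
    and B: "B = hecke_word (filter odd [1..<n] @ E)"
  shows "\<exists>l. \<forall>m. open_trace n (concat (replicate (Suc m) B)) = l ^ m * open_trace n B"
proof -
  let ?O = "hecke_word (filter odd [1..<n])" and ?E = "hecke_word E"
  have B': "B = ?O @ ?E" by (simp add: B)
  have "set B \<subseteq> braid_letters n"
    unfolding B by (rule set_hecke_word) (auto simp: E(1))
  then have letters: "1 \<le> i" "i < n" if "(i, c) \<in> set B" for i c
    using that by (auto simp: braid_letters_def)
  have proj: "odd_projected n (fock (B @ w) \<phi>)" for w \<phi>
    using odd_projected_fock[of n] by (simp add: B' fock_append)
  have "\<forall>s. \<exists>u. s \<subseteq> {1..n} \<and> card s \<le> n div 2 \<longrightarrow>
      (card s < n div 2 \<longrightarrow> u = 0) \<and> (\<forall>\<psi>. odd_projected n \<psi> \<longrightarrow> \<psi> s = \<psi> (odd_sites n) * u)"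
    using odd_projected_determined by meson
  from choice[OF this] obtain u where u': "\<forall>s. s \<subseteq> {1..n} \<and> card s \<le> n div 2 \<longrightarrow>
      (card s < n div 2 \<longrightarrow> u s = 0) \<and> (\<forall>\<psi>. odd_projected n \<psi> \<longrightarrow> \<psi> s = \<psi> (odd_sites n) * u s)" ..
  have u: "\<And>s. s \<subseteq> {1..n} \<Longrightarrow> card s < n div 2 \<Longrightarrow> u s = 0"
    "\<And>s \<psi>. s \<subseteq> {1..n} \<Longrightarrow> card s \<le> n div 2 \<Longrightarrow> odd_projected n \<psi> \<Longrightarrow> \<psi> s = \<psi> (odd_sites n) * u s"
    using u' less_imp_le by blast+
  \<comment> \<open>In degree n div 2 all odd-projected vectors are multiples of the profile
    \<open>u\<close>, the factor being the value at \<open>odd_sites n\<close>; so one value of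
    \<open>B\<close> applied to \<open>u\<close> gives the eigenvalue.\<close>
  define l where "l = fock B u (odd_sites n)"
  have step: "fock B \<psi> s = l * \<psi> s"
    if \<psi>: "odd_projected n \<psi>" and s: "s \<subseteq> {1..n}" "card s = n div 2" for \<psi> s
  proof -
    let ?Q = "\<lambda>x. x \<subseteq> {1..n} \<and> card x = n div 2"
    have "odd_projected n (fock B \<psi>)"
      using proj[of "[]"] by simp
    then have "fock B \<psi> s = fock B \<psi> (odd_sites n) * u s"
      using u(2) s by simp
    also have "fock B \<psi> (odd_sites n) = fock B (\<lambda>x. \<psi> (odd_sites n) * u x) (odd_sites n)"
    proof (rule fock_cong_invariant[where Q = ?Q])
      fix i c x assume "(i, c) \<in> set B" "?Q x"
      then show "?Q (swap_site i x)"
        using letters swap_site_subset by simp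
    next
      show "\<psi> x = \<psi> (odd_sites n) * u x" if "?Q x" for x
        using that u(2)[OF _ _ \<psi>] by simp
      show "?Q (odd_sites n)"
        using card_odd_sites by (auto simp: odd_sites_def odd_pos Suc_leI)
    qed
    also have "\<dots> * u s = l * (\<psi> (odd_sites n) * u s)"
      unfolding fock_scale l_def by (simp only: ac_simps)
    also have "\<psi> (odd_sites n) * u s = \<psi> s"
      using u(2)[OF s(1) _ \<psi>] s(2) by simp
    finally show ?thesis .
  qed
  have power: "fock (concat (replicate (Suc m) B)) \<phi> s = l ^ m * fock B \<phi> s"
    if s: "s \<subseteq> {1..n}" "card s = n div 2" for m \<phi> s
  proof (induction m)
    case (Suc m)
    have "fock (concat (replicate (Suc (Suc m)) B)) \<phi> s = l * fock (concat (replicate (Suc m) B)) \<phi> s"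
      using step[OF proj s, of "concat (replicate m B)" \<phi>] by (simp add: fock_append)
    then show ?case using Suc by (simp add: mult.assoc)
  qed simp
  have vanish: "fock (concat (replicate (Suc m) B)) (indicator_vec s) s = 0"
    if s: "s \<in> Pow {2..n}" "card s \<noteq> n div 2" for m s
  proof -
    have s1: "s \<subseteq> {1..n}" using s(1) by auto
    consider "card s < n div 2" | "n div 2 < card s" using s(2) by linarith
    then show ?thesis
    proof cases
      case 1
      then show ?thesis
        using u(2)[OF s1 _ proj, of "concat (replicate m B)" "indicator_vec s"] u(1)[OF s1] by simp
    next
      case 2
      \<comment> \<open>The power is split at its right end, since the rightmost even letters are
        the first to meet the initial state.\<close>
      have "concat (replicate (Suc m) B) = concat (replicate m B) @ ?O @ ?E" for m
        by (induction m) (simp_all add: B')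
      moreover have "fock w (\<lambda>_. 0) = (\<lambda>_. 0)" for w
        by (simp add: fun_eq_iff fock_zero)
      ultimately show ?thesis
        by (simp only: fock_append fock_even_word_crowded[OF E s(1) 2])
    qed
  qed
  have "open_trace n (concat (replicate (Suc m) B)) = l ^ m * open_trace n B" for m
    unfolding open_trace_def sum_distrib_left
  proof (rule sum.cong)
    fix s assume s: "s \<in> Pow {2..n}"
    then have s1: "s \<subseteq> {1..n}" by auto
    show "(-1) ^ card s * fock (concat (replicate (Suc m) B)) (indicator_vec s) s =
        l ^ m * ((-1) ^ card s * fock B (indicator_vec s) s)"
    proof (cases "card s = n div 2")
      case True
      show ?thesis unfolding power[OF s1 True] by (simp add: algebra_simps)
    next
      case False
      have "fock B (indicator_vec s) s = 0"
        using vanish[OF s False, of 0] by simp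
      then show ?thesis unfolding vanish[OF s False] by simp
    qed
  qed simp
  then show ?thesis by blast
qed

theorem alexander_trace_hecke_word_power:
  assumes "2 \<le> n"
  shows "alexander_trace n (concat (replicate (Suc m) (hecke_word [1..<n]))) =
    ((-1) ^ (n div 2) * qint n) ^ m"
proof -
  let ?W = "hecke_word [1..<n]"
  obtain E where E: "set E = {i. even i \<and> 2 \<le> i \<and> i < n}" "distinct E"
    and tr: "\<forall>m. open_trace n (concat (replicate m ?W)) =
      open_trace n (concat (replicate m (hecke_word (filter odd [1..<n] @ E))))"
    using open_trace_power_odd_even[OF assms] by (elim exE conjE)
  obtain l where l: "\<forall>m. open_trace n (concat (replicate (Suc m) (hecke_word (filter odd [1..<n] @ E)))) =
      l ^ m * open_trace n (hecke_word (filter odd [1..<n] @ E))"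
    using open_trace_power_rank_one[OF E refl] by (elim exE)
  have "open_trace n (concat (replicate (Suc m) ?W)) = l ^ m * open_trace n ?W" for m
    using spec[OF l, of m] spec[OF tr, of "Suc m"] spec[OF tr, of 1] by simp
  then have power: "alexander_trace n (concat (replicate (Suc m) ?W)) = l ^ m" for m
    using alexander_trace_hecke_word_upt[of n] assms
    by (simp add: alexander_trace_def algebra_simps)
  have "l = (-1) ^ (n div 2) * qint n"
    using power[of 1] alexander_trace_double_hecke_word[of n] assms by simp
  then show ?thesis using power by simp
qed

section \<open>Large exponents\<close>

definition order_ge :: "int \<Rightarrow> laurent \<Rightarrow> bool" where
  "order_ge c x \<longleftrightarrow> Poly_Mapping.keys x \<subseteq> {c..}"

text \<open>A polynomial in t is obtained by a shift only if all exponents of sqrt t have the same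
  parity; this is what the existence of a normalized form requires.\<close>

definition exponent_parity :: "int \<Rightarrow> laurent \<Rightarrow> bool" where
  "exponent_parity b x \<longleftrightarrow> Poly_Mapping.keys x \<subseteq> {k. even (k - b)}"

lemma order_ge_mono: "order_ge c x \<Longrightarrow> d \<le> c \<Longrightarrow> order_ge d x"
  by (auto simp: order_ge_def)

lemma order_ge_0 [simp]: "order_ge c 0"
  by (simp add: order_ge_def)

lemma order_ge_uminus [simp]: "order_ge c (- x) \<longleftrightarrow> order_ge c x"
  by (simp add: order_ge_def)

lemma order_ge_add: "order_ge c x \<Longrightarrow> order_ge c y \<Longrightarrow> order_ge c (x + y)"
  unfolding order_ge_def using Poly_Mapping.keys_add[of x y] by blast

lemma order_ge_diff: "order_ge c x \<Longrightarrow> order_ge c y \<Longrightarrow> order_ge c (x - y)"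
  using order_ge_add[of c x "- y"] by simp

lemma order_ge_mult: "order_ge c x \<Longrightarrow> order_ge d y \<Longrightarrow> order_ge (c + d) (x * y)"
  unfolding order_ge_def using keys_mult[of x y] by fastforce

lemma order_ge_sum: "(\<And>i. i \<in> I \<Longrightarrow> order_ge c (f i)) \<Longrightarrow> order_ge c (sum f I)"
  by (induction I rule: infinite_finite_induct) (auto intro: order_ge_add)

lemma order_ge_sqrt_t: "c \<le> a \<Longrightarrow> order_ge c (sqrt_t a)"
  by (simp add: order_ge_def sqrt_t_def)

lemma order_ge_1 [simp]: "order_ge 0 1"
  using order_ge_sqrt_t[of 0 0] by simp

lemma exponent_parity_0 [simp]: "exponent_parity b 0"
  by (simp add: exponent_parity_def)

lemma exponent_parity_uminus [simp]: "exponent_parity b (- x) \<longleftrightarrow> exponent_parity b x"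
  by (simp add: exponent_parity_def)

lemma exponent_parity_add: "exponent_parity b x \<Longrightarrow> exponent_parity b y \<Longrightarrow> exponent_parity b (x + y)"
  unfolding exponent_parity_def using Poly_Mapping.keys_add[of x y] by blast

lemma exponent_parity_diff: "exponent_parity b x \<Longrightarrow> exponent_parity b y \<Longrightarrow> exponent_parity b (x - y)"
  using exponent_parity_add[of b x "- y"] by simp

lemma exponent_parity_1: "even b \<Longrightarrow> exponent_parity b 1"
  by (simp add: exponent_parity_def)

lemma exponent_parity_mult:
  assumes "exponent_parity b x" "exponent_parity c y"
  shows "exponent_parity (b + c) (x * y)"
  unfolding exponent_parity_def
proof
  fix k assume "k \<in> Poly_Mapping.keys (x * y)"
  then obtain i j where "k = i + j" "i \<in> Poly_Mapping.keys x" "j \<in> Poly_Mapping.keys y"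
    using keys_mult[of x y] by blast
  moreover from this have "even (i - b)" "even (j - c)"
    using assms by (auto simp: exponent_parity_def)
  ultimately show "k \<in> {k. even (k - (b + c))}" by simp
qed

lemma exponent_parity_sum:
  "(\<And>i. i \<in> I \<Longrightarrow> exponent_parity b (f i)) \<Longrightarrow> exponent_parity b (sum f I)"
  by (induction I rule: infinite_finite_induct) (auto intro: exponent_parity_add)

lemma exponent_parity_sqrt_t: "even (a - b) \<Longrightarrow> exponent_parity b (sqrt_t a)"
  by (simp add: exponent_parity_def sqrt_t_def)

lemma exponent_parity_cong: "exponent_parity b x \<Longrightarrow> even (b - c) \<Longrightarrow> exponent_parity c x"
  unfolding exponent_parity_def by auto

lemma sign_mult_cases:
  assumes "\<epsilon> \<in> {1, -1 :: laurent}"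
  shows "order_ge c (\<epsilon> * x) \<longleftrightarrow> order_ge c x"
  using assms by auto

lemma order_ge_fock_op:
  assumes "\<And>s. order_ge b (\<phi> s)" "order_ge (-1) c"
  shows "order_ge (b - 1) (fock_op i c \<phi> s)"
proof -
  have m: "order_ge (b - 1) (x * \<phi> s)" if "order_ge (-1) x" for x
    using order_ge_mult[OF that assms(1)[of s]] by (simp add: algebra_simps)
  have "order_ge (-1) (rt - irt)"
    by (intro order_ge_diff order_ge_sqrt_t) simp_all
  moreover have "order_ge (b - 1) (\<phi> (swap_site i s))"
    using assms(1) by (rule order_ge_mono) simp
  ultimately show ?thesis
    unfolding fock_op_def using assms(2)
    by (auto intro!: order_ge_add order_ge_diff m simp: order_ge_sqrt_t)
qed

lemma order_ge_fock:
  assumes "\<And>s. order_ge b (\<phi> s)" "\<And>i c. (i, c) \<in> set w \<Longrightarrow> order_ge (-1) c"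
  shows "order_ge (b - int (length w)) (fock w \<phi> s)"
  using assms(2)
proof (induction w arbitrary: s)
  case Nil
  then show ?case using assms(1) by simp
next
  case (Cons x w)
  obtain i c where x: "x = (i, c)" by (cases x)
  have "order_ge (b - int (length w)) (fock w \<phi> s)" for s
    by (rule Cons.IH, rule Cons.prems) auto
  moreover have "order_ge (-1) c" using Cons.prems[of i c] x by simp
  ultimately have "order_ge (b - int (length w) - 1) (fock_op i c (fock w \<phi>) s)"
    by (rule order_ge_fock_op)
  then show ?case by (simp add: x algebra_simps)
qed

lemma sum_swap_site:
  assumes "finite s" "\<not> (i \<in> s \<longleftrightarrow> Suc i \<in> s)"
  shows "even (\<Sum>(swap_site i s) + \<Sum>s + 1)"
proof -
  have *: "\<Sum>(swap_site j s) = \<Sum>s + 1" if s: "finite s" "j \<in> s" "Suc j \<notin> s" for j s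
  proof -
    have "swap_site j s = insert (Suc j) (s - {j})"
      using s by (auto simp: swap_site_def)
    then have "\<Sum>(swap_site j s) = Suc j + \<Sum>(s - {j})"
      using s by simp
    also have "\<dots> = \<Sum>s + 1"
      using sum.remove[OF s(1,2), of "\<lambda>x. x"] by simp
    finally show ?thesis .
  qed
  show ?thesis
  proof (cases "i \<in> s")
    case True
    then show ?thesis using *[of s i] assms by simp
  next
    case False
    then have "i \<in> swap_site i s" "Suc i \<notin> swap_site i s"
      using assms by (simp_all add: swap_site_def)
    then show ?thesis using *[of "swap_site i s" i] finite_swap_site[OF assms(1)] by simp
  qed
qed

text \<open>The diagonal entries of a letter are odd in sqrt t, the off-diagonal entry 1 is even. A
  hop changes the sum of the occupied sites by one, so shifting the grading by this sum makes every
  letter homogeneous of odd parity.\<close>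

lemma exponent_parity_fock_op:
  assumes "\<And>s. finite s \<Longrightarrow> exponent_parity (b + int (\<Sum>s)) (\<phi> s)" "exponent_parity 1 c" "finite s"
  shows "exponent_parity (b + 1 + int (\<Sum>s)) (fock_op i c \<phi> s)"
proof -
  have m: "exponent_parity (b + 1 + int (\<Sum>s)) (x * \<phi> s)" if "exponent_parity 1 x" for x
    using exponent_parity_mult[OF that assms(1)[OF assms(3)]] by (simp add: algebra_simps)
  have "exponent_parity 1 (rt - irt)"
    by (intro exponent_parity_diff exponent_parity_sqrt_t) simp_all
  moreover have "exponent_parity (b + 1 + int (\<Sum>s)) (\<phi> (swap_site i s))"
    if "\<not> (i \<in> s \<longleftrightarrow> Suc i \<in> s)"
  proof (rule exponent_parity_cong)
    show "exponent_parity (b + int (\<Sum>(swap_site i s))) (\<phi> (swap_site i s))"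
      by (rule assms(1)) (rule finite_swap_site[OF assms(3)])
    show "even (b + int (\<Sum>(swap_site i s)) - (b + 1 + int (\<Sum>s)))"
      using sum_swap_site[OF assms(3) that] by presburger
  qed
  ultimately show ?thesis
    unfolding fock_op_def using assms(2)
    by (auto intro!: exponent_parity_add exponent_parity_diff m simp: exponent_parity_sqrt_t
        simp del: of_nat_sum)
qed

lemma exponent_parity_fock:
  assumes "\<And>s. finite s \<Longrightarrow> exponent_parity (b + int (\<Sum>s)) (\<phi> s)"
    and "\<And>i c. (i, c) \<in> set w \<Longrightarrow> exponent_parity 1 c" "finite s"
  shows "exponent_parity (b + int (length w) + int (\<Sum>s)) (fock w \<phi> s)"
  using assms(2,3)
proof (induction w arbitrary: s)
  case Nil
  then show ?case using assms(1) by simp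
next
  case (Cons x w)
  obtain i c where x: "x = (i, c)" by (cases x)
  have "exponent_parity (b + int (length w) + int (\<Sum>s)) (fock w \<phi> s)" if "finite s" for s
    by (rule Cons.IH[OF _ that], rule Cons.prems) auto
  moreover have "exponent_parity 1 c" using Cons.prems(1)[of i c] x by simp
  ultimately have "exponent_parity (b + int (length w) + 1 + int (\<Sum>s)) (fock_op i c (fock w \<phi>) s)"
    using Cons.prems(2) by (rule exponent_parity_fock_op)
  then show ?case by (simp add: x algebra_simps)
qed

lemma exponent_parity_alexander_trace:
  assumes "\<And>i c. (i, c) \<in> set w \<Longrightarrow> exponent_parity 1 c"
  shows "exponent_parity (int (n - 1) + int (length w)) (alexander_trace n w)"
proof -
  have "exponent_parity (int (length w)) ((-1) ^ card s * fock w (indicator_vec s) s)"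
    if s: "s \<in> Pow {2..n}" for s
  proof -
    have "finite s" using s finite_subset by blast
    \<comment> \<open>The trace returns to the state it starts from, so the shift enters twice and
      disappears modulo 2.\<close>
    have "exponent_parity (int (\<Sum>s) + int (\<Sum>x)) (indicator_vec s x)" for x
      by (simp add: indicator_vec_def exponent_parity_1 del: of_nat_sum)
    then have "exponent_parity (int (\<Sum>s) + int (length w) + int (\<Sum>s)) (fock w (indicator_vec s) s)"
      using assms \<open>finite s\<close> by (intro exponent_parity_fock)
    then have "exponent_parity (int (length w)) (fock w (indicator_vec s) s)"
      by (rule exponent_parity_cong) simp
    then show ?thesis by (cases "even (card s)") simp_all
  qed
  then have "exponent_parity (int (length w)) (open_trace n w)"
    unfolding open_trace_def by (rule exponent_parity_sum)
  moreover have "exponent_parity (int (n - 1)) (irt ^ (n - 1))"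
    by (simp add: sqrt_t_power exponent_parity_sqrt_t)
  ultimately show ?thesis
    unfolding alexander_trace_def by (rule exponent_parity_mult[rotated])
qed

section \<open>Spectral decomposition of large powers\<close>

lemma fock_op_eigen:
  "fock_op i c (fock_op i irt \<phi>) s = (rt + c) * fock_op i irt \<phi> s"
  "fock_op i c (fock_op i (- rt) \<phi>) s = (c - irt) * fock_op i (- rt) \<phi> s"
proof -
  have e: "fock_op i 0 (fock_op i d \<phi>) s = \<phi> s + (rt - irt + d) * fock_op i 0 \<phi> s" for d
  proof -
    have "fock_op i d \<phi> = (\<lambda>s. 1 * fock_op i 0 \<phi> s + d * \<phi> s)"
      using fock_op_const[of i d \<phi>] by auto
    then show ?thesis
      by (simp only: fock_op_linear fock_op_square) (simp add: algebra_simps)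
  qed
  show "fock_op i c (fock_op i irt \<phi>) s = (rt + c) * fock_op i irt \<phi> s"
    unfolding fock_op_const[of i c] e fock_op_const[of i irt] by (simp add: algebra_simps)
  show "fock_op i c (fock_op i (- rt) \<phi>) s = (c - irt) * fock_op i (- rt) \<phi> s"
    unfolding fock_op_const[of i c] e fock_op_const[of i "- rt"] by (simp add: algebra_simps)
qed

text \<open>The identity, multiplied by the eigenvalue difference rt + irt, is sigma_i + irt minus
  sigma_i - rt, and both of these map into eigenspaces. The constant c = 0 gives positive powers of
  sigma_i and c = irt - rt negative ones.\<close>

lemma fock_replicate:
  "(rt + irt) * fock (replicate p (i, c)) \<phi> s =
    (rt + c) ^ p * fock_op i irt \<phi> s - (c - irt) ^ p * fock_op i (- rt) \<phi> s"
proof (induction p arbitrary: s)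
  case 0
  have "fock_op i irt \<phi> s - fock_op i (- rt) \<phi> s = (rt + irt) * \<phi> s"
    unfolding fock_op_const[of i irt] fock_op_const[of i "- rt"] by (simp add: algebra_simps)
  then show ?case by simp
next
  case (Suc p)
  have "(rt + irt) * fock (replicate (Suc p) (i, c)) \<phi> s =
      fock_op i c (\<lambda>s. (rt + irt) * fock (replicate p (i, c)) \<phi> s) s"
    using fock_op_linear[of i c "rt + irt" "fock (replicate p (i, c)) \<phi>" 0 "\<lambda>_. 0" s] by simp
  also have "(\<lambda>s. (rt + irt) * fock (replicate p (i, c)) \<phi> s) =
      (\<lambda>s. (rt + c) ^ p * fock_op i irt \<phi> s + (- ((c - irt) ^ p)) * fock_op i (- rt) \<phi> s)"
    using Suc.IH by auto
  also have "fock_op i c (\<lambda>s. (rt + c) ^ p * fock_op i irt \<phi> s + (- ((c - irt) ^ p)) * fock_op i (- rt) \<phi> s) s = (rt + c) ^ Suc p * fock_op i irt \<phi> s - (c - irt) ^ Suc p * fock_op i (- rt) \<phi> s"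
    unfolding fock_op_linear fock_op_eigen by (simp add: algebra_simps)
  finally show ?case .
qed

text \<open>The constant for the complementary eigenspace, which carries the part of high
  order.\<close>

definition other_const :: "nat \<Rightarrow> laurent" where
  "other_const i = (if odd i then irt else - rt)"

lemma order_ge_const: "order_ge (-1) (hecke_const i)" "order_ge (-1) (other_const i)"
  by (simp_all add: hecke_const_def other_const_def order_ge_sqrt_t)

definition alternating_power :: "nat \<times> nat \<Rightarrow> braid_word" where
  "alternating_power = (\<lambda>(i, p). sigma_power i ((-1) ^ (i - 1) * int p))"

text \<open>The power of the eigenvalue of low order is factored out. Relative to it the other one
  has size rt^(2p), which is how large exponents push it out of the low coefficients.\<close>

lemma fock_alternating_power:
  assumes "1 \<le> i"
  shows "\<exists>\<epsilon>\<in>{1, -1}. \<exists>\<eta>\<in>{1, -1}. \<forall>\<phi> s.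
    (rt + irt) * fock (map signed_letter (alternating_power (i, p))) \<phi> s =
    \<epsilon> * irt ^ p * (fock_op i (hecke_const i) \<phi> s + \<eta> * rt ^ (2 * p) * fock_op i (other_const i) \<phi> s)"
proof -
  have sign: "(-1) ^ p \<in> {1, -1 :: laurent}" by (cases "even p") auto
  have cancel: "irt ^ p * rt ^ (2 * p) = rt ^ p"
    by (simp add: sqrt_t_power sqrt_t_mult)
  have expand: "e * irt ^ p * (a + e' * rt ^ (2 * p) * b) = e * (irt ^ p * a) + e * e' * (rt ^ p * b)"
    for e e' a b
    unfolding cancel[symmetric] by (simp only: algebra_simps)
  have square: "(-1) ^ p * (-1) ^ p = (1 :: laurent)"
    by (simp flip: power_add)
  show ?thesis
  proof (cases "odd i")
    case True
    have "map signed_letter (alternating_power (i, p)) = replicate p (i, 0)"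
      using True assms by (cases "p = 0") (simp_all add: alternating_power_def sigma_power_def signed_letter_def)
    then have "(rt + irt) * fock (map signed_letter (alternating_power (i, p))) \<phi> s =
        (- ((-1) ^ p)) * irt ^ p * (fock_op i (hecke_const i) \<phi> s
          + (- ((-1) ^ p)) * rt ^ (2 * p) * fock_op i (other_const i) \<phi> s)" for \<phi> s
      unfolding expand using fock_replicate[of p i 0 \<phi> s] True
      by (simp add: hecke_const_def other_const_def power_minus[of irt] square)
    then show ?thesis using sign
      by (intro bexI[of _ "- ((-1) ^ p)"] allI) auto
  next
    case False
    have "map signed_letter (alternating_power (i, p)) = replicate p (i, irt - rt)"
      using False assms by (cases "p = 0") (simp_all add: alternating_power_def sigma_power_def signed_letter_def)
    then have "(rt + irt) * fock (map signed_letter (alternating_power (i, p))) \<phi> s =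
        1 * irt ^ p * (fock_op i (hecke_const i) \<phi> s
          + (- ((-1) ^ p)) * rt ^ (2 * p) * fock_op i (other_const i) \<phi> s)" for \<phi> s
      unfolding expand using fock_replicate[of p i "irt - rt" \<phi> s] False
      by (simp add: hecke_const_def other_const_def power_minus[of rt] mult.assoc)
    then show ?thesis using sign
      by (intro bexI[of _ 1] bexI[of _ "- ((-1) ^ p)"] allI) auto
  qed
qed

lemma sign_mult: "x \<in> {1, -1 :: laurent} \<Longrightarrow> y \<in> {1, -1} \<Longrightarrow> x * y \<in> {1, -1}"
  by auto

text \<open>Every power is replaced by its low part. A new error starts with at least 2N from
  rt^(2p), and each letter costs at most one order. The sign is chosen before the vector, so that it
  can be taken out of the trace.\<close>

lemma fock_alternating_powers:
  assumes "\<And>i p. (i, p) \<in> set xs \<Longrightarrow> 1 \<le> i \<and> N \<le> p"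
  shows "\<exists>\<epsilon>\<in>{1, -1}. \<forall>\<phi>. (\<forall>s. order_ge 0 (\<phi> s)) \<longrightarrow> (\<exists>\<psi>. \<forall>s.
    (rt + irt) ^ length xs * fock (map signed_letter (concat (map alternating_power xs))) \<phi> s =
      \<epsilon> * irt ^ sum_list (map snd xs) * (fock (hecke_word (map fst xs)) \<phi> s + \<psi> s) \<and>
    order_ge (2 * int N - int (length xs)) (\<psi> s))"
  using assms
proof (induction xs)
  case Nil
  show ?case
    by (intro bexI[of _ 1] allI impI exI[of _ "\<lambda>_. 0"]) auto
next
  case (Cons x xs)
  obtain i p where x: "x = (i, p)" by (cases x)
  have ip: "1 \<le> i" "N \<le> p" using Cons.prems[of i p] x by auto
  define w where "w = map signed_letter (concat (map alternating_power xs))"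
  define v where "v = map signed_letter (alternating_power (i, p))"
  define h where "h = hecke_word (map fst xs)"
  let ?S = "sum_list (map snd xs)"
  have "\<And>i p. (i, p) \<in> set xs \<Longrightarrow> 1 \<le> i \<and> N \<le> p" using Cons.prems by auto
  from Cons.IH[OF this] obtain \<epsilon> where \<epsilon>: "\<epsilon> \<in> {1, -1}" and IH: "\<And>\<phi>. (\<forall>s. order_ge 0 (\<phi> s)) \<Longrightarrow> (\<exists>\<psi>. \<forall>s.
    (rt + irt) ^ length xs * fock w \<phi> s = \<epsilon> * irt ^ ?S * (fock h \<phi> s + \<psi> s) \<and>
    order_ge (2 * int N - int (length xs)) (\<psi> s))"
    unfolding w_def h_def by blast
  from fock_alternating_power[OF ip(1), of p] obtain \<epsilon>' \<eta> where \<epsilon>': "\<epsilon>' \<in> {1, -1}" and \<eta>: "\<eta> \<in> {1, -1}"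
    and pow: "\<And>\<phi> s. (rt + irt) * fock v \<phi> s =
      \<epsilon>' * irt ^ p * (fock_op i (hecke_const i) \<phi> s + \<eta> * rt ^ (2 * p) * fock_op i (other_const i) \<phi> s)"
    unfolding v_def by blast
  show ?case
  proof (intro bexI[of _ "\<epsilon> * \<epsilon>'"] allI impI)
    show "\<epsilon> * \<epsilon>' \<in> {1, -1}" by (rule sign_mult[OF \<epsilon> \<epsilon>'])
    fix \<phi> :: "nat set \<Rightarrow> laurent" assume \<phi>: "\<forall>s. order_ge 0 (\<phi> s)"
    from IH[OF this] obtain \<psi> where \<psi>: "\<And>s. (rt + irt) ^ length xs * fock w \<phi> s = \<epsilon> * irt ^ ?S * (fock h \<phi> s + \<psi> s)"
      "\<And>s. order_ge (2 * int N - int (length xs)) (\<psi> s)" by blast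
    define \<chi> where "\<chi> = (\<lambda>s. fock h \<phi> s + \<psi> s)"
    define \<psi>' where "\<psi>' s = fock_op i (hecke_const i) \<psi> s + \<eta> * rt ^ (2 * p) * fock_op i (other_const i) \<chi> s" for s
    have eq: "(rt + irt) ^ length (x # xs) * fock (map signed_letter (concat (map alternating_power (x # xs)))) \<phi> s =
      \<epsilon> * \<epsilon>' * irt ^ sum_list (map snd (x # xs)) * (fock (hecke_word (map fst (x # xs))) \<phi> s + \<psi>' s)" for s
    proof -
      have "(rt + irt) ^ length (x # xs) * fock (map signed_letter (concat (map alternating_power (x # xs)))) \<phi> s =
          (rt + irt) * ((rt + irt) ^ length xs * fock v (fock w \<phi>) s)"
        by (simp add: x v_def w_def fock_append mult.assoc)
      also have "(rt + irt) ^ length xs * fock v (fock w \<phi>) s = fock v (\<lambda>s. (rt + irt) ^ length xs * fock w \<phi> s) s"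
        by (simp add: fock_scale)
      also have "(\<lambda>s. (rt + irt) ^ length xs * fock w \<phi> s) = (\<lambda>s. \<epsilon> * irt ^ ?S * \<chi> s)"
        using \<psi>(1) by (simp add: \<chi>_def)
      also have "(rt + irt) * fock v (\<lambda>s. \<epsilon> * irt ^ ?S * \<chi> s) s = \<epsilon> * irt ^ ?S * ((rt + irt) * fock v \<chi> s)"
        unfolding fock_scale by (simp only: ac_simps)
      also have "\<dots> = \<epsilon> * \<epsilon>' * irt ^ (p + ?S) *
          (fock_op i (hecke_const i) \<chi> s + \<eta> * rt ^ (2 * p) * fock_op i (other_const i) \<chi> s)"
        unfolding pow power_add by (simp only: ac_simps)
      also have "fock_op i (hecke_const i) \<chi> s = fock_op i (hecke_const i) (fock h \<phi>) s + fock_op i (hecke_const i) \<psi> s"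
        using fock_op_linear[of i "hecke_const i" 1 "fock h \<phi>" 1 \<psi> s] by (simp add: \<chi>_def)
      finally show ?thesis
        by (simp add: x h_def \<psi>'_def add.assoc)
    qed
    have "order_ge (2 * int N - int (length (x # xs))) (\<psi>' s)" for s
    proof -
      have "order_ge (0 - int (length h)) (fock h \<phi> s)" for s
        using \<phi> by (intro order_ge_fock) (auto simp: h_def hecke_word_def order_ge_const)
      then have "order_ge (- int (length xs)) (\<chi> s)" for s
        unfolding \<chi>_def using \<psi>(2)[of s]
        by (intro order_ge_add) (auto simp: h_def hecke_word_def elim: order_ge_mono)
      then have "order_ge (- int (length xs) - 1) (fock_op i (other_const i) \<chi> s)"
        by (rule order_ge_fock_op) (rule order_ge_const)
      moreover have "order_ge (2 * int N) (\<eta> * rt ^ (2 * p))"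
        unfolding sign_mult_cases[OF \<eta>] sqrt_t_power using ip by (intro order_ge_sqrt_t) simp
      ultimately have "order_ge (2 * int N + (- int (length xs) - 1)) (\<eta> * rt ^ (2 * p) * fock_op i (other_const i) \<chi> s)"
        by (rule order_ge_mult[rotated])
      moreover have "order_ge (2 * int N - int (length xs) - 1) (fock_op i (hecke_const i) \<psi> s)"
        using \<psi>(2) by (rule order_ge_fock_op) (rule order_ge_const)
      ultimately show ?thesis
        unfolding \<psi>'_def by (intro order_ge_add) (simp_all add: algebra_simps)
    qed
    with eq show "\<exists>\<psi>. \<forall>s.
      (rt + irt) ^ length (x # xs) * fock (map signed_letter (concat (map alternating_power (x # xs)))) \<phi> s =
      \<epsilon> * \<epsilon>' * irt ^ sum_list (map snd (x # xs)) * (fock (hecke_word (map fst (x # xs))) \<phi> s + \<psi> s) \<and>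
      order_ge (2 * int N - int (length (x # xs))) (\<psi> s)"
      by blast
  qed
qed

lemma alexander_trace_alternating_powers:
  assumes "\<And>i p. (i, p) \<in> set xs \<Longrightarrow> 1 \<le> i \<and> N \<le> p"
  shows "\<exists>\<epsilon>\<in>{1, -1}. \<exists>\<Psi>.
    (rt + irt) ^ length xs * alexander_trace n (map signed_letter (concat (map alternating_power xs))) =
      \<epsilon> * irt ^ sum_list (map snd xs) * (alexander_trace n (hecke_word (map fst xs)) + \<Psi>) \<and>
    order_ge (2 * int N - int (length xs) - int (n - 1)) \<Psi>"
proof -
  let ?w = "map signed_letter (concat (map alternating_power xs))" and ?h = "hecke_word (map fst xs)"
  let ?S = "irt ^ sum_list (map snd xs)"
  from fock_alternating_powers[OF assms]
  obtain \<epsilon> where \<epsilon>: "\<epsilon> \<in> {1, -1}" and ex: "\<forall>\<phi>. (\<forall>s. order_ge 0 (\<phi> s)) \<longrightarrow> (\<exists>\<psi>. \<forall>s.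
    (rt + irt) ^ length xs * fock ?w \<phi> s = \<epsilon> * ?S * (fock ?h \<phi> s + \<psi> s) \<and>
    order_ge (2 * int N - int (length xs)) (\<psi> s))"
    by (rule bexE)
  have "\<forall>r. \<exists>\<psi>. \<forall>s. (rt + irt) ^ length xs * fock ?w (indicator_vec r) s =
      \<epsilon> * ?S * (fock ?h (indicator_vec r) s + \<psi> s) \<and> order_ge (2 * int N - int (length xs)) (\<psi> s)"
    by (intro allI ex[rule_format]) (simp add: indicator_vec_def)
  \<comment> \<open>One error vector for each basis vector, to be summed along the diagonal.\<close>
  from choice[OF this] obtain \<psi> where \<psi>: "\<And>r s. (rt + irt) ^ length xs * fock ?w (indicator_vec r) s =
      \<epsilon> * ?S * (fock ?h (indicator_vec r) s + \<psi> r s)" "\<And>r s. order_ge (2 * int N - int (length xs)) (\<psi> r s)"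
    by blast
  define \<Psi> where "\<Psi> = irt ^ (n - 1) * (\<Sum>s\<in>Pow {2..n}. (-1) ^ card s * \<psi> s s)"
  have "(rt + irt) ^ length xs * open_trace n ?w =
      (\<Sum>s\<in>Pow {2..n}. (-1) ^ card s * ((rt + irt) ^ length xs * fock ?w (indicator_vec s) s))"
    unfolding open_trace_def sum_distrib_left by (simp only: ac_simps)
  also have "\<dots> = \<epsilon> * ?S * (open_trace n ?h + (\<Sum>s\<in>Pow {2..n}. (-1) ^ card s * \<psi> s s))"
    unfolding \<psi>(1) open_trace_def by (simp add: sum_distrib_left sum.distrib[symmetric] algebra_simps)
  finally have trace: "(rt + irt) ^ length xs * open_trace n ?w =
      \<epsilon> * ?S * (open_trace n ?h + (\<Sum>s\<in>Pow {2..n}. (-1) ^ card s * \<psi> s s))" .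
  have "(rt + irt) ^ length xs * alexander_trace n ?w =
      irt ^ (n - 1) * ((rt + irt) ^ length xs * open_trace n ?w)"
    unfolding alexander_trace_def by (simp only: ac_simps)
  then have "(rt + irt) ^ length xs * alexander_trace n ?w = \<epsilon> * ?S * (alexander_trace n ?h + \<Psi>)"
    unfolding trace unfolding alexander_trace_def \<Psi>_def by (simp only: algebra_simps)
  moreover have "order_ge (- int (n - 1) + (2 * int N - int (length xs))) \<Psi>"
    unfolding \<Psi>_def
  proof (intro order_ge_mult order_ge_sum)
    show "order_ge (- int (n - 1)) (irt ^ (n - 1))"
      by (simp add: sqrt_t_power order_ge_sqrt_t)
    fix s
    show "order_ge (2 * int N - int (length xs)) ((-1) ^ card s * \<psi> s s)"
      using \<psi>(2) by (cases "even (card s)") simp_all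
  qed
  ultimately show ?thesis
    using \<epsilon> by (intro bexI[of _ \<epsilon>] exI[of _ \<Psi>]) (simp_all add: algebra_simps)
qed

section \<open>Expansion for the closure of the given braid\<close>

definition geometric :: "nat \<Rightarrow> laurent" where
  "geometric n = (\<Sum>i<n. sqrt_t (2 * int i))"

lemma qint_geometric: "qint n = sqrt_t (1 - int n) * geometric n"
  by (simp add: qint_def geometric_def sum_distrib_left sqrt_t_mult algebra_simps)

lemma sign_power: "(-1 :: laurent) ^ k \<in> {1, -1}"
  by (cases "even k") auto

lemma closure_beta_expansion:
  assumes \<Delta>: "is_alexander_polynomial \<Delta>" and n: "2 \<le> n" and m: "1 \<le> m"
    and p: "\<forall>i\<in>{1..n - 1}. \<forall>j\<in>{1..m}. int N \<le> p i j"
  shows "\<exists>\<epsilon>\<in>{1, -1}. \<exists>e \<Psi>.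
    (1 + sqrt_t 2) ^ ((n - 1) * m) * \<Delta> (braid_closure n (beta n m p)) =
      \<epsilon> * sqrt_t e * (geometric n ^ (m - 1) + \<Psi>) \<and>
    order_ge (2 * int N - int ((n - 1) * m) - int n) \<Psi>"
proof -
  define xs where "xs = concat (map (\<lambda>j. map (\<lambda>i. (i, nat (p i j))) [1..<n]) [1..<m + 1])"
  define K where "K = (n - 1) * m"
  define S where "S = sum_list (map snd xs)"
  have xs: "1 \<le> i \<and> i < n \<and> (\<exists>j. j \<in> {1..m} \<and> e = nat (p i j))" if "(i, e) \<in> set xs" for i e
    using that by (auto simp: xs_def)
  have beta: "beta n m p = concat (map alternating_power xs)"
  proof -
    have "sigma_power i ((-1) ^ (i - 1) * p i j) = alternating_power (i, nat (p i j))"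
      if "j \<in> set [1..<m + 1]" "i \<in> set [1..<n]" for i j
    proof -
      have "int N \<le> p i j" using that p by auto
      then show ?thesis by (simp add: alternating_power_def)
    qed
    then have "beta n m p = concat (map (\<lambda>j. concat (map (\<lambda>i. alternating_power (i, nat (p i j))) [1..<n])) [1..<m + 1])"
      unfolding beta_def by (intro arg_cong[of _ _ concat] map_cong refl)
    also have "\<dots> = concat (map alternating_power xs)"
    proof -
      have "concat (map (\<lambda>j. concat (map f (g j))) js) = concat (map f (concat (map g js)))"
        for f :: "nat \<times> nat \<Rightarrow> braid_word" and g and js :: "nat list"
        by (induction js) simp_all
      from this[of alternating_power "\<lambda>j. map (\<lambda>i. (i, nat (p i j))) [1..<n]"] show ?thesis
        unfolding xs_def by (simp add: o_def)
    qed
    finally show ?thesis .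
  qed
  have len: "length xs = K"
    by (simp add: xs_def K_def length_concat o_def sum_list_triv)
  have fst: "hecke_word (map fst xs) = concat (replicate m (hecke_word [1..<n]))"
  proof -
    have "map fst xs = concat (map (\<lambda>j. [1..<n]) [1..<m + 1])"
      by (simp add: xs_def map_concat o_def)
    also have "\<dots> = concat (replicate m [1..<n])"
      by (simp add: map_replicate_const)
    finally show ?thesis by (simp add: hecke_word_def map_concat)
  qed
  have pos: "1 \<le> i \<and> N \<le> e" if "(i, e) \<in> set xs" for i e
  proof -
    from xs[OF that] obtain j where "1 \<le> i" "i < n" "j \<in> {1..m}" "e = nat (p i j)" by blast
    moreover from this have "int N \<le> p i j" using p by auto
    ultimately show ?thesis by simp
  qed
  have letters: "set (beta n m p) \<subseteq> braid_letters n"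
  proof
    fix y assume "y \<in> set (beta n m p)"
    then obtain i e where ie: "(i, e) \<in> set xs" "y \<in> set (alternating_power (i, e))"
      unfolding beta by auto
    then show "y \<in> braid_letters n"
      using xs[OF ie(1)] by (auto simp: alternating_power_def sigma_power_def braid_letters_def)
  qed
  have closure: "\<Delta> (braid_closure n (beta n m p)) =
      alexander_trace n (map signed_letter (concat (map alternating_power xs)))" (is "?P = _")
    using alexander_closure[OF \<Delta> _ letters] n by (simp add: beta)
  obtain \<epsilon> \<Psi> where \<epsilon>: "\<epsilon> \<in> {1, -1}" and \<Psi>: "(rt + irt) ^ K * ?P = \<epsilon> * irt ^ S *
      (alexander_trace n (concat (replicate m (hecke_word [1..<n]))) + \<Psi>)"
      "order_ge (2 * int N - int K - int (n - 1)) \<Psi>"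
    using alexander_trace_alternating_powers[of xs N n] pos
    unfolding closure len fst S_def by blast
  obtain k where k: "m = Suc k" using m by (cases m) auto
  define \<eta> :: laurent where "\<eta> = (-1) ^ (n div 2 * k)"
  have \<eta>: "\<eta> \<in> {1, -1}" unfolding \<eta>_def by (rule sign_power)
  then have \<eta>2: "\<eta> * \<eta> = 1" by auto
  \<comment> \<open>The exponent of the unit that separates \<open>qint n ^ k\<close> from
    \<open>geometric n ^ k\<close>. It is at most 0, so taking this unit out of the error only
    raises its order.\<close>
  define f where "f = (1 - int n) * int k"
  have "alexander_trace n (concat (replicate m (hecke_word [1..<n]))) = \<eta> * sqrt_t f * geometric n ^ k"
    unfolding k alexander_trace_hecke_word_power[OF n] qint_geometric
    by (simp add: power_mult_distrib sqrt_t_power \<eta>_def f_def mult.assoc flip: power_mult)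
  moreover have "\<Psi> = \<eta> * sqrt_t f * (\<eta> * sqrt_t (- f) * \<Psi>)"
  proof -
    have "\<eta> * sqrt_t f * (\<eta> * sqrt_t (- f) * \<Psi>) = (\<eta> * \<eta>) * (sqrt_t f * sqrt_t (- f)) * \<Psi>"
      by (simp only: ac_simps)
    then show ?thesis by (simp add: \<eta>2 sqrt_t_mult)
  qed
  ultimately have eq: "(rt + irt) ^ K * ?P =
      \<epsilon> * irt ^ S * (\<eta> * sqrt_t f * (geometric n ^ k + \<eta> * sqrt_t (- f) * \<Psi>))"
    unfolding \<Psi>(1) by (metis distrib_left)
  have "1 + sqrt_t 2 = rt * (rt + irt)"
    by (simp add: distrib_left sqrt_t_mult)
  then have "(1 + sqrt_t 2) ^ K * ?P = sqrt_t (int K) * ((rt + irt) ^ K * ?P)"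
    by (simp add: power_mult_distrib sqrt_t_power mult.assoc)
  also have "\<dots> = (\<epsilon> * \<eta>) * (sqrt_t (int K) * sqrt_t (- int S) * sqrt_t f) *
      (geometric n ^ k + \<eta> * sqrt_t (- f) * \<Psi>)"
    unfolding eq by (simp add: sqrt_t_power ac_simps)
  also have "sqrt_t (int K) * sqrt_t (- int S) * sqrt_t f = sqrt_t (int K - int S + f)"
    by (simp add: sqrt_t_mult)
  finally have "(1 + sqrt_t 2) ^ K * ?P =
      (\<epsilon> * \<eta>) * sqrt_t (int K - int S + f) * (geometric n ^ (m - 1) + \<eta> * sqrt_t (- f) * \<Psi>)"
    by (simp add: k)
  moreover have "order_ge (2 * int N - int K - int n) (\<eta> * sqrt_t (- f) * \<Psi>)"
  proof -
    have "order_ge 0 (\<eta> * sqrt_t (- f))"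
      unfolding sign_mult_cases[OF \<eta>] using n
      by (intro order_ge_sqrt_t) (simp add: f_def mult_nonpos_nonneg)
    from order_ge_mult[OF this \<Psi>(2)] show ?thesis
      by (rule order_ge_mono) simp
  qed
  ultimately show ?thesis
    using sign_mult[OF \<epsilon> \<eta>] unfolding K_def by blast
qed

lemma closure_exponent_parity:
  assumes "is_alexander_polynomial \<Delta>" "1 \<le> n" "set w \<subseteq> braid_letters n"
  shows "exponent_parity (int (n - 1) + int (length w)) (\<Delta> (braid_closure n w))"
proof -
  have "exponent_parity 1 (irt - rt)"
    by (intro exponent_parity_diff exponent_parity_sqrt_t) simp_all
  then have "exponent_parity (int (n - 1) + int (length (map signed_letter w)))
      (alexander_trace n (map signed_letter w))"
    by (intro exponent_parity_alexander_trace) (auto simp: signed_letter_def)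
  then show ?thesis
    by (simp add: alexander_closure[OF assms])
qed

text \<open>\<open>laurent\<close> is the free abelian group on the exponents, so
  \<open>frag_induction\<close> reduces the claim to monomials.\<close>

lemma lookup_sqrt_t_mult: "Poly_Mapping.lookup (sqrt_t a * x) k = Poly_Mapping.lookup x (k - a)"
proof -
  have "Poly_Mapping.keys x \<subseteq> UNIV" by simp
  then have "\<forall>k. Poly_Mapping.lookup (sqrt_t a * x) k = Poly_Mapping.lookup x (k - a)"
  proof (induction x rule: frag_induction)
    case (one b)
    have "sqrt_t a * frag_of b = frag_of (a + b)"
      by (simp add: sqrt_t_def mult_single)
    then show ?case by auto
  qed (simp_all add: algebra_simps lookup_minus)
  then show ?thesis by blast
qed

lemma lookup_sqrt_t_mult_sum:
  "Poly_Mapping.lookup ((\<Sum>i\<in>I. sqrt_t (f i)) * x) k = (\<Sum>i\<in>I. Poly_Mapping.lookup x (k - f i))"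
  by (simp add: sum_distrib_right lookup_sum lookup_sqrt_t_mult)

section \<open>The coefficients\<close>

definition eval_s :: "int poly \<Rightarrow> laurent" where
  "eval_s A = (\<Sum>i\<le>degree A. of_int (coeff A i) * (- sqrt_t 2) ^ i)"

lemma eval_s_term: "of_int a * (- sqrt_t 2) ^ i = Poly_Mapping.single (2 * int i) ((-1) ^ i * a)"
proof -
  have "(- sqrt_t 2) ^ i = Poly_Mapping.single 0 ((-1) ^ i) * Poly_Mapping.single (2 * int i) 1"
    unfolding power_minus[of "sqrt_t 2"] sqrt_t_power
    by (cases "even i") (simp_all add: single_uminus sqrt_t_def)
  then show ?thesis
    by (simp add: mult_single mult.commute flip: single_of_int)
qed

lemma lookup_eval_s:
  "Poly_Mapping.lookup (eval_s A) (2 * int i) = (-1) ^ i * coeff A i"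
  "(\<And>i. k \<noteq> 2 * int i) \<Longrightarrow> Poly_Mapping.lookup (eval_s A) k = 0"
proof -
  have "Poly_Mapping.lookup (eval_s A) (2 * int i) = (\<Sum>j\<le>degree A. if j = i then (-1) ^ i * coeff A i else 0)"
    unfolding eval_s_def eval_s_term lookup_sum by (intro sum.cong) (auto simp: lookup_single when_def)
  then show "Poly_Mapping.lookup (eval_s A) (2 * int i) = (-1) ^ i * coeff A i"
    by (simp add: coeff_eq_0)
  show "Poly_Mapping.lookup (eval_s A) k = 0" if "\<And>i. k \<noteq> 2 * int i"
    unfolding eval_s_def eval_s_term lookup_sum
    using that by (intro sum.neutral) (simp add: lookup_single when_def; metis)
qed

lemma normalized_in_s_alt:
  "normalized_in_s P A \<longleftrightarrow> coeff A 0 > 0 \<and> (\<exists>k. \<exists>\<epsilon>\<in>{1, -1}. P = \<epsilon> * sqrt_t k * eval_s A)"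
  by (simp add: normalized_in_s_def eval_s_def)

text \<open>The shift is the least exponent k; as all exponents are congruent to k modulo 2, what
  remains is a polynomial in t.\<close>

lemma normalized_in_s_exists:
  assumes "P \<noteq> 0" "exponent_parity b P"
  shows "\<exists>A. normalized_in_s P A"
proof -
  define k where "k = Min (Poly_Mapping.keys P)"
  have ne: "Poly_Mapping.keys P \<noteq> {}" using assms(1) by simp
  have k: "k \<in> Poly_Mapping.keys P" "\<And>j. j \<in> Poly_Mapping.keys P \<Longrightarrow> k \<le> j"
    unfolding k_def using ne by (simp_all add: Min_in)
  define c where "c = Poly_Mapping.lookup P k"
  have c: "c \<noteq> 0" using k(1) by (simp add: c_def in_keys_iff)
  define D where "D = nat (Max (Poly_Mapping.keys P) - k)"
  \<comment> \<open>The sign of the lowest coefficient makes the constant term positive, and (-1)^i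
    is the substitution t = -s.\<close>
  define a where "a i = sgn c * (-1) ^ i * Poly_Mapping.lookup P (k + 2 * int i)" for i
  define A where "A = (\<Sum>i\<le>D. monom (a i) i)"
  have a0: "a i = 0" if "D < i" for i
  proof -
    have "k + 2 * int i \<notin> Poly_Mapping.keys P"
    proof
      assume "k + 2 * int i \<in> Poly_Mapping.keys P"
      then have "k + 2 * int i \<le> Max (Poly_Mapping.keys P)" by simp
      then show False using that unfolding D_def by linarith
    qed
    then show ?thesis by (simp add: a_def in_keys_iff)
  qed
  have coeff: "coeff A i = a i" for i
  proof -
    have "coeff A i = (\<Sum>j\<le>D. if j = i then a i else 0)"
      unfolding A_def coeff_sum by (intro sum.cong) auto
    then show ?thesis using a0[of i] by auto
  qed
  define \<epsilon> :: laurent where "\<epsilon> = of_int (sgn c)"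
  have \<epsilon>: "\<epsilon> \<in> {1, -1}" using c by (auto simp: \<epsilon>_def sgn_if)
  have "P = \<epsilon> * sqrt_t k * eval_s A"
  proof (rule poly_mapping_eqI)
    fix j
    have l: "Poly_Mapping.lookup (\<epsilon> * sqrt_t k * eval_s A) j = sgn c * Poly_Mapping.lookup (eval_s A) (j - k)"
      using c by (auto simp: \<epsilon>_def sgn_if lookup_sqrt_t_mult mult.assoc)
    show "Poly_Mapping.lookup P j = Poly_Mapping.lookup (\<epsilon> * sqrt_t k * eval_s A) j"
    proof (cases "\<exists>i. j - k = 2 * int i")
      case True
      then obtain i where i: "j - k = 2 * int i" by blast
      then have j: "j = k + 2 * int i" by simp
      have "sgn c * sgn c = 1" using c by (simp add: sgn_if)
      then have "sgn c * ((-1) ^ i * (sgn c * (-1) ^ i * x)) = x" for x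
        by (cases "even i") (simp_all flip: mult.assoc)
      then show ?thesis unfolding l i lookup_eval_s coeff a_def by (simp add: j)
    next
      case False
      have "j \<notin> Poly_Mapping.keys P"
      proof
        assume j: "j \<in> Poly_Mapping.keys P"
        then have "even (j - b)" "even (k - b)"
          using k(1) assms(2) by (auto simp: exponent_parity_def)
        then have "even (j - k)" by presburger
        moreover have "0 \<le> j - k" using k(2)[OF j] by simp
        ultimately have "j - k = 2 * int (nat ((j - k) div 2))" by simp
        with False show False by blast
      qed
      then show ?thesis unfolding l using lookup_eval_s(2)[of "j - k" A] False by (auto simp: in_keys_iff)
    qed
  qed
  moreover have "coeff A 0 > 0"
    using c by (simp add: coeff a_def sgn_if flip: c_def)
  ultimately show ?thesis
    using \<epsilon> unfolding normalized_in_s_alt by blast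
qed

section \<open>Comparison of the coefficients of t^0, ..., t^3\<close>

abbreviation lk :: "laurent \<Rightarrow> int \<Rightarrow> real" where "lk x k \<equiv> real_of_int (Poly_Mapping.lookup x k)"

text \<open>Convolution with the binomial coefficients of K, by Pascal's rule. Written over the
  reals, they vanish by themselves when K is too small.\<close>

lemma lookup_one_plus_power:
  assumes "\<And>k. k < 0 \<Longrightarrow> Poly_Mapping.lookup x k = 0"
  defines "y K \<equiv> (1 + sqrt_t 2) ^ K * x"
  shows "k < 0 \<Longrightarrow> Poly_Mapping.lookup (y K) k = 0"
    and "lk (y K) 0 = lk x 0"
    and "lk (y K) 2 = lk x 2 + K * lk x 0"
    and "lk (y K) 4 = lk x 4 + K * lk x 2 + K * (real K - 1) / 2 * lk x 0"
    and "lk (y K) 6 = lk x 6 + K * lk x 4 + K * (real K - 1) / 2 * lk x 2 + K * (real K - 1) * (real K - 2) / 6 * lk x 0"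
proof -
  have rec: "Poly_Mapping.lookup (y (Suc K)) k = Poly_Mapping.lookup (y K) k + Poly_Mapping.lookup (y K) (k - 2)" for K k
    using lookup_sqrt_t_mult[of 2 "y K" k] by (simp add: y_def lookup_add distrib_right mult.assoc)
  have neg: "Poly_Mapping.lookup (y K) k = 0" if "k < 0" for K k
    using that by (induction K arbitrary: k) (simp_all add: rec, simp add: y_def assms)
  show "k < 0 \<Longrightarrow> Poly_Mapping.lookup (y K) k = 0" by (rule neg)
  have y0: "y 0 = x" by (simp add: y_def)
  show 0: "lk (y K) 0 = lk x 0" for K
    by (induction K) (simp_all add: rec neg y0)
  show 2: "lk (y K) 2 = lk x 2 + K * lk x 0" for K
    by (induction K) (simp_all add: rec y0 0 algebra_simps)
  show 4: "lk (y K) 4 = lk x 4 + K * lk x 2 + K * (real K - 1) / 2 * lk x 0" for K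
    by (induction K) (simp_all add: rec y0 2 field_simps)
  show "lk (y K) 6 = lk x 6 + K * lk x 4 + K * (real K - 1) / 2 * lk x 2 + K * (real K - 1) * (real K - 2) / 6 * lk x 0"
    by (induction K) (simp_all add: rec y0 4 field_simps)
qed

text \<open>Up to t^2, and for n > 3 up to t^3, these are the coefficients of (1 - t)^(-M). For n =
  3 the factor has no t^3, which lowers the coefficient of t^3 by M.\<close>

lemma lookup_geometric_power:
  assumes "3 \<le> n"
  defines "y M \<equiv> geometric n ^ M"
  shows "k < 0 \<Longrightarrow> Poly_Mapping.lookup (y M) k = 0"
    and "lk (y M) 0 = 1"
    and "lk (y M) 2 = M"
    and "lk (y M) 4 = real M * (real M + 1) / 2"
    and "lk (y M) 6 = (real M - 1) * real M * (real M + 1) / 6 + real M * (real M - 1) / 2 + (if n = 3 then 0 else real M)"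
proof -
  have rec: "Poly_Mapping.lookup (y (Suc M)) k = (\<Sum>i<n. Poly_Mapping.lookup (y M) (k - 2 * int i))" for M k
    unfolding y_def power_Suc geometric_def by (rule lookup_sqrt_t_mult_sum)
  have y0: "y 0 = 1" by (simp add: y_def)
  have neg: "Poly_Mapping.lookup (y M) k = 0" if "k < 0" for M k
    using that by (induction M arbitrary: k) (simp_all add: rec y0 lookup_one)
  show "k < 0 \<Longrightarrow> Poly_Mapping.lookup (y M) k = 0" by (rule neg)
  \<comment> \<open>Terms of the factor beyond the exponent in question meet only negative
    exponents, so a fixed number r of terms is enough.\<close>
  have trunc: "Poly_Mapping.lookup (y (Suc M)) k = (\<Sum>i<r. Poly_Mapping.lookup (y M) (k - 2 * int i))"
    if "k < 2 * int r" "r \<le> n" for M k r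
    unfolding rec using that by (intro sum.mono_neutral_right) (auto simp: neg)
  have 0: "lk (y M) 0 = 1" for M
    using assms(1) by (induction M) (simp_all add: trunc[where k = 0 and r = 1] y0)
  have 2: "lk (y M) 2 = M" for M
    using assms(1)
    by (induction M) (simp_all add: trunc[where k = 2 and r = 2] y0 0 lookup_one numeral_2_eq_2)
  have 4: "lk (y M) 4 = real M * (real M + 1) / 2" for M
    using assms(1)
    by (induction M) (simp_all add: trunc[where k = 4 and r = 3] y0 0 2 lookup_one numeral_3_eq_3 field_simps)
  show "lk (y M) 0 = 1" "lk (y M) 2 = M" "lk (y M) 4 = real M * (real M + 1) / 2"
    by (fact 0 2 4)+
  show "lk (y M) 6 = (real M - 1) * real M * (real M + 1) / 6 + real M * (real M - 1) / 2 + (if n = 3 then 0 else real M)"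
  proof (cases "n = 3")
    case True
    then show ?thesis
      by (induction M) (simp_all add: rec y0 2 4 lookup_one numeral_3_eq_3 field_simps)
  next
    case False
    then have "4 \<le> n" using assms(1) by simp
    have four: "{..<4} = {0, 1, 2, 3 :: nat}" by auto
    show ?thesis
      using False \<open>4 \<le> n\<close>
      by (induction M) (simp_all add: trunc[where k = 6 and r = 4] four y0 0 2 4 lookup_one field_simps)
  qed
qed

lemma normalized_coefficients:
  assumes "3 \<le> n" "1 \<le> m" and norm: "normalized_in_s P A"
    and \<eta>: "\<eta> \<in> {1, -1}"
    and eq: "(1 + sqrt_t 2) ^ ((n - 1) * m) * P = \<eta> * sqrt_t e * (geometric n ^ (m - 1) + \<Psi>)"
    and \<Psi>: "order_ge 8 \<Psi>"
  shows "coeff A 0 = 1"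
    and "real_of_int (coeff A 1) = (real n - 2) * real m + 1"
    and "real_of_int (coeff A 2) = ((real n - 2) ^ 2 * real m ^ 2 + (3 * (real n - 2) + 2) * real m) / 2"
    and "n > 3 \<Longrightarrow> real_of_int (coeff A 3) =
      ((real n - 2) ^ 3 * real m ^ 3 + 6 * (real n - 1) * (real n - 2) * real m ^ 2
        + (5 * (real n - 1) + 1) * real m) / 6"
    and "n = 3 \<Longrightarrow> real_of_int (coeff A 3) = (real m ^ 3 + 12 * real m ^ 2 + 17 * real m - 6) / 6"
proof -
  from norm obtain k \<epsilon> where a0: "coeff A 0 > 0" and \<epsilon>: "\<epsilon> \<in> {1, -1}" and P: "P = \<epsilon> * sqrt_t k * eval_s A"
    unfolding normalized_in_s_alt by blast
  define K where "K = (n - 1) * m"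
  define Y where "Y = (1 + sqrt_t 2) ^ K * eval_s A"
  define Z where "Z = geometric n ^ (m - 1) + \<Psi>"
  have neg: "Poly_Mapping.lookup (eval_s A) j = 0" if "j < 0" for j
    using that by (intro lookup_eval_s(2)) auto
  note Y = lookup_one_plus_power[where x = "eval_s A" and K = K, OF neg, folded Y_def]
  note ev = lookup_eval_s(1)[of A 0, simplified] lookup_eval_s(1)[of A 1, simplified]
    lookup_eval_s(1)[of A 2, simplified] lookup_eval_s(1)[of A 3, simplified]
  have \<Psi>0: "Poly_Mapping.lookup \<Psi> j = 0" if "j < 8" for j
    using \<Psi> that by (force simp: order_ge_def in_keys_iff)
  note G = lookup_geometric_power[where n = n and M = "m - 1", OF assms(1)]
  have Z: "Poly_Mapping.lookup Z j = Poly_Mapping.lookup (geometric n ^ (m - 1)) j" if "j < 8" for j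
    using \<Psi>0[OF that] by (simp add: Z_def lookup_add)
  have Z_neg: "Poly_Mapping.lookup Z j = 0" if "j < 0" for j
    using Z[of j] G(1)[OF that] that by simp
  have Y_neg: "Poly_Mapping.lookup Y j = 0" if "j < 0" for j
    using Y(1)[OF _ that] by blast
  have Z0: "Poly_Mapping.lookup Z 0 = 1" and Y0: "Poly_Mapping.lookup Y 0 = coeff A 0"
    using Z[of 0] G(2) Y(2) ev(1) by simp_all
  obtain x y :: int where xy: "x \<in> {1, -1}" "y \<in> {1, -1}" "\<epsilon> = of_int x" "\<eta> = of_int y"
    using \<epsilon> \<eta> by (metis insert_iff of_int_1 of_int_minus singletonD)
  have sgn: "Poly_Mapping.lookup (of_int z * w) j = z * Poly_Mapping.lookup w j" if "z \<in> {1, -1}" for z w j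
    using that by auto
  have YZ: "x * Poly_Mapping.lookup Y (j - k) = y * Poly_Mapping.lookup Z (j - e)" for j
  proof -
    have "\<epsilon> * (sqrt_t k * Y) = \<eta> * (sqrt_t e * Z)"
      using eq unfolding P Y_def Z_def K_def by (simp only: ac_simps)
    then have "Poly_Mapping.lookup (\<epsilon> * (sqrt_t k * Y)) j = Poly_Mapping.lookup (\<eta> * (sqrt_t e * Z)) j"
      by simp
    then show ?thesis
      by (simp only: xy(3,4) sgn[OF xy(1)] sgn[OF xy(2)] lookup_sqrt_t_mult)
  qed
  \<comment> \<open>Both sides begin with a nonzero constant term, so comparing the lowest exponents
    identifies the units; positivity of \<open>coeff A 0\<close> then settles the sign.\<close>
  have "\<not> k < e"
    using YZ[of k] Y0 Z_neg[of "k - e"] a0 xy(1) by auto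
  moreover have "\<not> e < k"
    using YZ[of e] Z0 Y_neg[of "e - k"] xy(2) by auto
  ultimately have ke: "k = e" by simp
  have "x * coeff A 0 = y"
    using YZ[of k] Y0 Z0 ke by simp
  then have c0: "coeff A 0 = 1" and "x = y"
    using xy(1,2) a0 by auto
  then have YZ': "Poly_Mapping.lookup Y j = Poly_Mapping.lookup Z j" for j
    using YZ[of "j + k"] ke xy(2) by auto
  show "coeff A 0 = 1" by (rule c0)
  have m: "real (m - 1) = real m - 1" using assms(2) by simp
  have K: "real K = (real n - 1) * real m" using assms(1) by (simp add: K_def)
  \<comment> \<open>The identity (1 + t)^K A(-t) = (1 + t + ... + t^(n-1))^(m-1) modulo t^4 is a
    triangular system for the coefficients of A.\<close>
  have c1: "real_of_int (coeff A 1) = K - real (m - 1)"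
    using Y(3) G(3) Z[of 2] YZ'[of 2] ev c0 by simp
  have c2: "real_of_int (coeff A 2) = real (m - 1) * (real (m - 1) + 1) / 2 + K * real_of_int (coeff A 1)
      - K * (real K - 1) / 2"
    using Y(4) G(4) Z[of 4] YZ'[of 4] ev c0 by simp
  have c3: "real_of_int (coeff A 3) = K * real_of_int (coeff A 2) - K * (real K - 1) / 2 * real_of_int (coeff A 1)
      + K * (real K - 1) * (real K - 2) / 6
      - ((real (m - 1) - 1) * real (m - 1) * (real (m - 1) + 1) / 6 + real (m - 1) * (real (m - 1) - 1) / 2
        + (if n = 3 then 0 else real (m - 1)))"
    using Y(5) G(5) Z[of 6] YZ'[of 6] ev c0 by simp
  show "real_of_int (coeff A 1) = (real n - 2) * real m + 1"
    unfolding c1 K m by (simp add: algebra_simps)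
  show "real_of_int (coeff A 2) = ((real n - 2) ^ 2 * real m ^ 2 + (3 * (real n - 2) + 2) * real m) / 2"
    unfolding c2 c1 K m by (simp add: field_simps power2_eq_square)
  show "real_of_int (coeff A 3) =
      ((real n - 2) ^ 3 * real m ^ 3 + 6 * (real n - 1) * (real n - 2) * real m ^ 2
        + (5 * (real n - 1) + 1) * real m) / 6" if "n > 3"
    unfolding c3 c2 c1 K m using that by (simp add: field_simps power2_eq_square power3_eq_cube)
  show "real_of_int (coeff A 3) = (real m ^ 3 + 12 * real m ^ 2 + 17 * real m - 6) / 6" if "n = 3"
    unfolding c3 c2 c1 K m using that by (simp add: field_simps power2_eq_square power3_eq_cube)
qed

section \<open>Log-concavity of the explicit values, with k = n - 2\<close>

lemma log_concave_generic:
  fixes k m :: real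
  assumes "1 \<le> k" "1 \<le> m"
  defines "a1 \<equiv> k * m + 1" and "a2 \<equiv> (k ^ 2 * m ^ 2 + (3 * k + 2) * m) / 2"
  shows "a2 \<le> a1 ^ 2"
    and "a1 * ((k ^ 3 * m ^ 3 + 6 * (k + 1) * k * m ^ 2 + (5 * (k + 1) + 1) * m) / 6) \<le> a2 ^ 2"
proof -
  have km: "m \<le> k * m" "m \<le> m * m" using assms by simp_all
  then have "m * m \<le> (k * m) * (k * m)" using assms by (intro mult_mono) simp_all
  with km have "0 \<le> (k * m) * (k * m) + k * m - 2 * m + 2" by linarith
  then show "a2 \<le> a1 ^ 2" unfolding a1_def a2_def by (simp add: field_simps power2_eq_square)
  \<comment> \<open>The polynomial 36 (a2^2 - a1 a3) has a single negative term, linear in m; the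
    quadratic terms absorb it because m <= m^2.\<close>
  have "(30 * k + 36) * m \<le> (15 * k ^ 2 + 36 * k + 36) * m ^ 2"
  proof (rule mult_mono)
    show "30 * k + 36 \<le> 15 * k ^ 2 + 36 * k + 36" using assms by simp
    show "m \<le> m ^ 2" using km by (simp add: power2_eq_square)
  qed (use assms in simp_all)
  moreover have "0 \<le> 3 * k ^ 4 * m ^ 4 + 12 * k ^ 3 * m ^ 3" using assms by simp
  ultimately have "0 \<le> 3 * k ^ 4 * m ^ 4 + 12 * k ^ 3 * m ^ 3 + (15 * k ^ 2 + 36 * k + 36) * m ^ 2 - (30 * k + 36) * m"
    by linarith
  also have "\<dots> = 36 * (a2 ^ 2 - a1 * ((k ^ 3 * m ^ 3 + 6 * (k + 1) * k * m ^ 2 + (5 * (k + 1) + 1) * m) / 6))"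
    unfolding a1_def a2_def by (simp add: field_simps power2_eq_square power3_eq_cube power4_eq_xxxx)
  finally show "a1 * ((k ^ 3 * m ^ 3 + 6 * (k + 1) * k * m ^ 2 + (5 * (k + 1) + 1) * m) / 6) \<le> a2 ^ 2"
    by simp
qed

lemma log_concave_three_strands:
  fixes m :: real
  assumes "1 \<le> m"
  shows "(m + 1) * ((m ^ 3 + 12 * m ^ 2 + 17 * m - 6) / 6) \<le> ((m ^ 2 + 5 * m) / 2) ^ 2"
    and "0 \<le> m ^ 3 + 12 * m ^ 2 + 17 * m - 6"
proof -
  have "1 * m \<le> m * m" using assms by (intro mult_right_mono) simp_all
  then have sq: "m \<le> m ^ 2" by (simp add: power2_eq_square)
  have "1 * m \<le> m ^ 2 * m" using assms by (intro mult_right_mono) simp_all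
  then have cube: "m \<le> m ^ 3" by (simp add: power2_eq_square power3_eq_cube)
  \<comment> \<open>Since m is at most each of m^2, m^3, m^4 and 3 + 12 + 51 = 66, the positive
    terms outweigh 66 m.\<close>
  have "m \<le> m ^ 4" using assms by (intro self_le_power) simp_all
  then have "0 \<le> 3 * m ^ 4 + 12 * m ^ 3 + 51 * m ^ 2 - 66 * m + 36" using sq cube assms by linarith
  also have "\<dots> = 36 * (((m ^ 2 + 5 * m) / 2) ^ 2 - (m + 1) * ((m ^ 3 + 12 * m ^ 2 + 17 * m - 6) / 6))"
    by (simp add: field_simps power2_eq_square power3_eq_cube power4_eq_xxxx)
  finally show "(m + 1) * ((m ^ 3 + 12 * m ^ 2 + 17 * m - 6) / 6) \<le> ((m ^ 2 + 5 * m) / 2) ^ 2"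
    by simp
  show "0 \<le> m ^ 3 + 12 * m ^ 2 + 17 * m - 6"
    using assms sq cube by linarith
qed

theorem mainTheorem5:
  fixes n m :: nat
  assumes "n \<ge> 3" and "m \<ge> 1"
  shows "\<exists>N::int. \<forall>(\<Delta> :: diagram \<Rightarrow> laurent) (p :: nat \<Rightarrow> nat \<Rightarrow> int).
    is_alexander_polynomial \<Delta> \<longrightarrow>
    (\<forall>i\<in>{1..n - 1}. \<forall>j\<in>{1..m}. p i j \<ge> N) \<longrightarrow>
    (\<exists>A. normalized_in_s (\<Delta> (braid_closure n (beta n m p))) A) \<and>
    (\<forall>A. normalized_in_s (\<Delta> (braid_closure n (beta n m p))) A \<longrightarrow>
      coeff A 0 = 1 \<and>
      real_of_int (coeff A 1) = (real n - 2) * real m + 1 \<and>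
      real_of_int (coeff A 2) =
        ((real n - 2) ^ 2 * real m ^ 2 + (3 * (real n - 2) + 2) * real m) / 2 \<and>
      (n > 3 \<longrightarrow> real_of_int (coeff A 3) =
        ((real n - 2) ^ 3 * real m ^ 3 + 6 * (real n - 1) * (real n - 2) * real m ^ 2
          + (5 * (real n - 1) + 1) * real m) / 6) \<and>
      (n = 3 \<longrightarrow> real_of_int (coeff A 3) =
        (real m ^ 3 + 12 * real m ^ 2 + 17 * real m - 6) / 6) \<and>
      (coeff A 1)\<^sup>2 \<ge> \<bar>coeff A 0\<bar> * \<bar>coeff A 2\<bar> \<and>
      (coeff A 2)\<^sup>2 \<ge> \<bar>coeff A 1\<bar> * \<bar>coeff A 3\<bar>)"
proof -
  \<comment> \<open>Chosen so that 2N - (n - 1) m - n is at least 8: order 8 in sqrt t is order 4 in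
    t, beyond the four coefficients wanted.\<close>
  define N where "N = (n - 1) * m + n + 8"
  show ?thesis
  proof (intro exI[of _ "int N"] allI impI)
    fix \<Delta> :: "diagram \<Rightarrow> laurent" and p :: "nat \<Rightarrow> nat \<Rightarrow> int"
    assume \<Delta>: "is_alexander_polynomial \<Delta>" and p: "\<forall>i\<in>{1..n - 1}. \<forall>j\<in>{1..m}. p i j \<ge> int N"
    define P where "P = \<Delta> (braid_closure n (beta n m p))"
    have "2 \<le> n" using assms(1) by simp
    from closure_beta_expansion[OF \<Delta> this assms(2) p]
    obtain \<eta> e \<Psi> where \<eta>: "\<eta> \<in> {1, -1}"
      and eq: "(1 + sqrt_t 2) ^ ((n - 1) * m) * P = \<eta> * sqrt_t e * (geometric n ^ (m - 1) + \<Psi>)"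
      and "order_ge (2 * int N - int ((n - 1) * m) - int n) \<Psi>"
      unfolding P_def by (elim bexE exE conjE)
    then have \<Psi>: "order_ge 8 \<Psi>"
      by (auto elim!: order_ge_mono simp: N_def)
    \<comment> \<open>The constant term of the expansion is 1, which the error cannot reach.\<close>
    have "P \<noteq> 0"
    proof
      assume "P = 0"
      then have "\<eta> * (sqrt_t e * (geometric n ^ (m - 1) + \<Psi>)) = 0"
        using eq by (simp add: mult.assoc)
      then have "sqrt_t e * (geometric n ^ (m - 1) + \<Psi>) = 0"
        using \<eta> by auto
      then have "Poly_Mapping.lookup (geometric n ^ (m - 1) + \<Psi>) 0 = 0"
        using lookup_sqrt_t_mult[of e "geometric n ^ (m - 1) + \<Psi>" e]
        by (simp only: diff_self Poly_Mapping.lookup_zero)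
      moreover have "Poly_Mapping.lookup \<Psi> 0 = 0"
        using \<Psi> by (force simp: order_ge_def in_keys_iff)
      moreover have "Poly_Mapping.lookup (geometric n ^ (m - 1)) 0 = 1"
        using lookup_geometric_power(2)[where M = "m - 1", OF assms(1)] by simp
      ultimately show False by (simp add: lookup_add)
    qed
    moreover have "set (beta n m p) \<subseteq> braid_letters n"
      by (auto simp: beta_def sigma_power_def braid_letters_def)
    then have "exponent_parity (int (n - 1) + int (length (beta n m p))) P"
      unfolding P_def using assms(1) by (intro closure_exponent_parity[OF \<Delta>]) simp_all
    ultimately have ex: "\<exists>A. normalized_in_s P A"
      by (rule normalized_in_s_exists)
    have "coeff A 0 = 1 \<and>
      real_of_int (coeff A 1) = (real n - 2) * real m + 1 \<and>
      real_of_int (coeff A 2) =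
        ((real n - 2) ^ 2 * real m ^ 2 + (3 * (real n - 2) + 2) * real m) / 2 \<and>
      (n > 3 \<longrightarrow> real_of_int (coeff A 3) =
        ((real n - 2) ^ 3 * real m ^ 3 + 6 * (real n - 1) * (real n - 2) * real m ^ 2
          + (5 * (real n - 1) + 1) * real m) / 6) \<and>
      (n = 3 \<longrightarrow> real_of_int (coeff A 3) =
        (real m ^ 3 + 12 * real m ^ 2 + 17 * real m - 6) / 6) \<and>
      (coeff A 1)\<^sup>2 \<ge> \<bar>coeff A 0\<bar> * \<bar>coeff A 2\<bar> \<and>
      (coeff A 2)\<^sup>2 \<ge> \<bar>coeff A 1\<bar> * \<bar>coeff A 3\<bar>" if "normalized_in_s P A" for A
    proof -
      note c = normalized_coefficients[OF assms that \<eta> eq \<Psi>]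
      define k where "k = real n - 2"
      have k: "1 \<le> k" "1 \<le> real m" using assms by (simp_all add: k_def)
      note lc = log_concave_generic[OF k]
      let ?a = "\<lambda>i. real_of_int (coeff A i)"
      have c1: "?a 1 = k * real m + 1" and c2: "?a 2 = (k ^ 2 * real m ^ 2 + (3 * k + 2) * real m) / 2"
        using c(2,3) by (simp_all add: k_def)
      \<comment> \<open>All the coefficients turn out to be nonnegative, which removes the absolute
        values from the inequalities.\<close>
      have nonneg: "0 \<le> ?a 1" "0 \<le> ?a 2"
        unfolding c1 c2 using k by simp_all
      have "0 \<le> ?a 3 \<and> ?a 1 * ?a 3 \<le> ?a 2 ^ 2"
      proof (cases "n = 3")
        case True
        then have a: "?a 1 = real m + 1" "?a 2 = (real m ^ 2 + 5 * real m) / 2"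
          using c1 c2 by (simp_all add: k_def)
        show ?thesis
          unfolding a c(5)[OF True] using log_concave_three_strands[OF k(2)] by simp
      next
        case False
        then have "n > 3" using assms(1) by simp
        have c3: "?a 3 = (k ^ 3 * real m ^ 3 + 6 * (k + 1) * k * real m ^ 2 + (5 * (k + 1) + 1) * real m) / 6"
          using c(4)[OF \<open>n > 3\<close>] by (simp add: k_def algebra_simps)
        show ?thesis
          unfolding c1 c2 c3 using lc(2) k by simp
      qed
      then have "0 \<le> ?a 3" "real_of_int (coeff A 1 * coeff A 3) \<le> real_of_int ((coeff A 2)\<^sup>2)"
        by simp_all
      moreover have "real_of_int (coeff A 2) \<le> real_of_int ((coeff A 1)\<^sup>2)"
        using lc(1) c1 c2 by simp
      ultimately have "\<bar>coeff A 0\<bar> * \<bar>coeff A 2\<bar> \<le> (coeff A 1)\<^sup>2" "\<bar>coeff A 1\<bar> * \<bar>coeff A 3\<bar> \<le> (coeff A 2)\<^sup>2"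
        using nonneg c(1) unfolding of_int_le_iff of_int_0_le_iff by simp_all
      then show ?thesis using c by blast
    qed
    then show "(\<exists>A. normalized_in_s (\<Delta> (braid_closure n (beta n m p))) A) \<and>
      (\<forall>A. normalized_in_s (\<Delta> (braid_closure n (beta n m p))) A \<longrightarrow>
      coeff A 0 = 1 \<and>
      real_of_int (coeff A 1) = (real n - 2) * real m + 1 \<and>
      real_of_int (coeff A 2) =
        ((real n - 2) ^ 2 * real m ^ 2 + (3 * (real n - 2) + 2) * real m) / 2 \<and>
      (n > 3 \<longrightarrow> real_of_int (coeff A 3) =
        ((real n - 2) ^ 3 * real m ^ 3 + 6 * (real n - 1) * (real n - 2) * real m ^ 2
          + (5 * (real n - 1) + 1) * real m) / 6) \<and>
      (n = 3 \<longrightarrow> real_of_int (coeff A 3) =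
        (real m ^ 3 + 12 * real m ^ 2 + 17 * real m - 6) / 6) \<and>
      (coeff A 1)\<^sup>2 \<ge> \<bar>coeff A 0\<bar> * \<bar>coeff A 2\<bar> \<and>
      (coeff A 2)\<^sup>2 \<ge> \<bar>coeff A 1\<bar> * \<bar>coeff A 3\<bar>)"
      using ex unfolding P_def by blast
  qed
qed

end
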